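(* Let $k\ge0$, $n,q\ge1$, $\mathcal{X}\subset\mathbb{R}^n$ open, and let $\Psi\in C^0(\mathcal{X},\mathbb{R}^q)$ if $k=0$, or $\Psi\in C^k_b(\mathcal{X},\mathbb{R}^q)$ if $k\ge1$, be globally Lipschitz continuous with constant $K_\Psi\in[0,\infty)$ (w.r.t. $\|\cdot\|_\infty$). Fix $K\in[0,\infty)$, $\tau\in(0,T]$ and $w,\tilde w\in(0,\infty)$ with $$K\tau\ \ge\ 2\Big(1+\frac{K_\Psi}{w\tilde w}\Big).$$ Then, with $m=\max\{n,q\}$, there exists a (non-augmented) neural DDE $\Phi\in\mathrm{NDDE}^k_\tau(\mathcal{X},\mathbb{R}^q)$ with $\Phi(x)=\Psi(x)$ for all $x\in\mathcal{X}$, such that its vector field $F:\mathbb{R}\times\Omega_y\to\mathbb{R}^m$ is globally Lipschitz continuous in the second variable on $\mathbb{R}\times\Omega_0$ with Lipschitz constant $K$, where $\Omega_0=\{c_{\lambda(x)}:x\in\mathcal{X}\}\subset\Omega_y$, and its weight matrices satisfy $\|W\|_\infty=w$ and $\|\tilde W\|_\infty=\tilde w$.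
   Context: Throughout, $\|\cdot\|_\infty$ denotes the max-norm on $\mathbb{R}^d$ and, for a matrix $A\in\mathbb{R}^{r\times s}$, the induced norm $\|A\|_\infty=\max_{\|x\|_\infty=1}\|Ax\|_\infty$. Fix $T>0$, a delay $\tau\in[0,T]$ and $m\ge1$, and let $\mathcal{C}=C^0([-\tau,0],\mathbb{R}^m)$ with norm $\|u\|_\infty=\sup_{s\in[-\tau,0]}\|u(s)\|_\infty$. For a function $y$ defined on $[t-\tau,t]$, $y_t\in\mathcal{C}$ is $y_t(s)=y(t+s)$. For $a\in\mathbb{R}^m$, $c_a\in\mathcal{C}$ is the constant function $c_a(s)=a$. Given $F:\Omega\to\mathbb{R}^m$, $\Omega\subset\mathbb{R}\times\mathcal{C}$ open, and $(t_0,u)\in\Omega$, a solution of the DDE $\frac{dy}{dt}=F(t,y_t)$ ($t\ge t_0$), $y_{t_0}=u$, is a continuous $y:[t_0-\tau,t_0+c)\to\mathbb{R}^m$, $c\in(0,\infty]$, with $y_{t_0}=u$, $(t,y_t)\in\Omega$ and $y'(t)=F(t,y_t)$ for $t\in[t_0,t_0+c)$; it is denoted $y(t_0,u)$. $\mathcal{I}_a$ denotes the maximal interval of existence of $y(0,c_a)$. For $k\ge1$, $C^{0,k}_b(\Omega,\mathbb{R}^m)$ denotes the continuous maps $F$ on $\Omega$ that are $k$ times continuously Fréchet differentiable in the second variable with the derivatives of orders $1,\dots,k$ bounded on $\Omega$. Neural DDE: let $n,q\ge1$, $\mathcal{X}\subset\mathbb{R}^n$ open, $\lambda(x)=Wx+b$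 with $W\in\mathbb{R}^{m\times n}$, $b\in\mathbb{R}^m$, $\tilde\lambda(y)=\tilde Wy+\tilde b$ with $\tilde W\in\mathbb{R}^{q\times m}$, $\tilde b\in\mathbb{R}^q$, and $F:\Omega_t\times\Omega_y\to\mathbb{R}^m$ with $\Omega_t\subset\mathbb{R}$, $\Omega_y\subset\mathcal{C}$ open, satisfying the well-definedness conditions: $[0,T]\subset\Omega_t$, $\Omega_0:=\{c_{\lambda(x)}:x\in\mathcal{X}\}\subset\Omega_y$, and $[-\tau,T]\subset\mathcal{I}_{\lambda(x)}$ for all $x\in\mathcal{X}$. The associated neural DDE is $\Phi:\mathcal{X}\to\mathbb{R}^q$, $\Phi(x)=\tilde\lambda(y(0,c_{\lambda(x)})(T))$. For $k\ge1$, $\mathrm{NDDE}^k_\tau(\mathcal{X},\mathbb{R}^q)$ is the set of all such $\Phi$ with $F\in C^{0,k}_b(\Omega_t\times\Omega_y,\mathbb{R}^m)$; $\mathrm{NDDE}^0_\tau(\mathcal{X},\mathbb{R}^q)$ is the set of all such $\Phi$ for which the solutions $y(0,c_{\lambda(x)})$ are unique and continuous (and $\Phi$ is continuous). $\Phi$ is non-augmented if $m\le\max\{n,q\}$ and augmented if $m>\max\{n,q\}$. $C^k_b(\mathcal{X},\mathbb{R}^q)$ denotes the $k$ times continuously differentiable maps whose derivatives of orders $1,\dots,k$ are bounded on $\mathcal{X}$. A map $F:\Omega_t\times\Omega_y\to\mathbb{R}^m$ is globally Lipschitz continuous in the second variable on $\Omega_t\times\Omega_0$ with constant $K$ if $\|F(t,u)-F(t,v)\|_\infty\le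 K\|u-v\|_\infty$ for all $t\in\Omega_t$ and $u,v\in\Omega_0$. *)

theory Defs
  imports "HOL-Analysis.Analysis"
begin

section \<open>Norms\<close>

text \<open>Induced max-norm of a matrix A (r rows, s columns):
  sup of the max-norm of A x over all x with max-norm 1.\<close>
definition mat_infnorm :: "real^'s^'r \<Rightarrow> real" where
  "mat_infnorm A = Sup {infnorm (A *v x) | x. infnorm x = 1}"

section \<open>The phase space C = C^0([-tau,0], R^m)\<close>

text \<open>Elements of C are represented as functions real => real^m that are continuous
  on [-tau,0] and vanish outside [-tau,0] (a canonical representative).\<close>
definition Cset :: "real \<Rightarrow> (real \<Rightarrow> real^'m) set" where
  "Cset tau = {u. continuous_on {-tau..0} u \<and> (\<forall>s. s \<notin> {-tau..0} \<longrightarrow> u s = 0)}"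

definition cnorm :: "real \<Rightarrow> (real \<Rightarrow> real^'m) \<Rightarrow> real" where
  "cnorm tau u = (SUP s\<in>{-tau..0}. infnorm (u s))"

text \<open>The segment y_t.\<close>
definition seg :: "real \<Rightarrow> (real \<Rightarrow> real^'m) \<Rightarrow> real \<Rightarrow> (real \<Rightarrow> real^'m)" where
  "seg tau y t = (\<lambda>s. if s \<in> {-tau..0} then y (t + s) else 0)"

text \<open>The constant function c_a.\<close>
definition cconst :: "real \<Rightarrow> real^'m \<Rightarrow> (real \<Rightarrow> real^'m)" where
  "cconst tau a = (\<lambda>s. if s \<in> {-tau..0} then a else 0)"

definition Cadd :: "(real \<Rightarrow> real^'m) \<Rightarrow> (real \<Rightarrow> real^'m) \<Rightarrow> (real \<Rightarrow> real^'m)" where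
  "Cadd u v = (\<lambda>s. u s + v s)"

definition Cdiff :: "(real \<Rightarrow> real^'m) \<Rightarrow> (real \<Rightarrow> real^'m) \<Rightarrow> (real \<Rightarrow> real^'m)" where
  "Cdiff u v = (\<lambda>s. u s - v s)"

definition Cscale :: "real \<Rightarrow> (real \<Rightarrow> real^'m) \<Rightarrow> (real \<Rightarrow> real^'m)" where
  "Cscale c u = (\<lambda>s. c *\<^sub>R u s)"

text \<open>Open subsets of C (w.r.t. the sup max-norm).\<close>
definition C_open :: "real \<Rightarrow> (real \<Rightarrow> real^'m) set \<Rightarrow> bool" where
  "C_open tau U \<longleftrightarrow> U \<subseteq> Cset tau \<and>
     (\<forall>u\<in>U. \<exists>e>0. \<forall>v\<in>Cset tau. cnorm tau (Cdiff v u) < e \<longrightarrow> v \<in> U)"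

section \<open>Higher Frechet derivatives in the second variable (generic)\<close>

text \<open>Setting: a vector space of directions V inside a type 'a, with addition pl,
  scalar multiplication sc and norm na; target normed by nb.
  A j-th derivative is represented as a function of a list of j directions.\<close>

definition ml_bounded ::
  "('a \<Rightarrow> 'a \<Rightarrow> 'a) \<Rightarrow> (real \<Rightarrow> 'a \<Rightarrow> 'a) \<Rightarrow> ('a \<Rightarrow> real) \<Rightarrow> ('b::real_vector \<Rightarrow> real)
    \<Rightarrow> 'a set \<Rightarrow> nat \<Rightarrow> ('a list \<Rightarrow> 'b) \<Rightarrow> bool" where
  "ml_bounded pl sc na nb V j M \<longleftrightarrow>
     (\<forall>hs i h h' c. length hs = j \<and> set hs \<subseteq> V \<and> i < j \<and> h \<in> V \<and> h' \<in> V \<longrightarrow>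
        M (hs[i := pl h h']) = M (hs[i := h]) + M (hs[i := h']) \<and>
        M (hs[i := sc c h]) = c *\<^sub>R M (hs[i := h])) \<and>
     (\<exists>B. \<forall>hs. length hs = j \<and> set hs \<subseteq> V \<longrightarrow> nb (M hs) \<le> B * prod_list (map na hs))"

text \<open>Operator norm of a j-linear map.\<close>
definition ml_norm ::
  "('a \<Rightarrow> real) \<Rightarrow> ('b \<Rightarrow> real) \<Rightarrow> 'a set \<Rightarrow> nat \<Rightarrow> ('a list \<Rightarrow> 'b) \<Rightarrow> real" where
  "ml_norm na nb V j M =
     Sup ({0} \<union> {nb (M hs) | hs. length hs = j \<and> set hs \<subseteq> V \<and> (\<forall>h\<in>set hs. na h \<le> 1)})"

text \<open>D is a family of derivatives D j t u of F t in the second variable up to order k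
  on S (a subset of real x V-part), with D 0 = F, each D (j+1) the Frechet derivative
  of D j (in operator norm), and all D j (j <= k) jointly continuous on S.\<close>
definition deriv_family ::
  "('a \<Rightarrow> 'a \<Rightarrow> 'a) \<Rightarrow> (real \<Rightarrow> 'a \<Rightarrow> 'a) \<Rightarrow> ('a \<Rightarrow> real) \<Rightarrow> ('b::real_vector \<Rightarrow> real)
    \<Rightarrow> 'a set \<Rightarrow> (real \<times> 'a) set \<Rightarrow> (real \<Rightarrow> 'a \<Rightarrow> 'b) \<Rightarrow> nat
    \<Rightarrow> (nat \<Rightarrow> real \<Rightarrow> 'a \<Rightarrow> 'a list \<Rightarrow> 'b) \<Rightarrow> bool" where
  "deriv_family pl sc na nb V S F k D \<longleftrightarrow>
     (\<forall>(t,u)\<in>S. D 0 t u [] = F t u) \<and>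
     (\<forall>j\<le>k. \<forall>(t,u)\<in>S. ml_bounded pl sc na nb V j (D j t u)) \<and>
     (\<forall>j<k. \<forall>(t,u)\<in>S. \<forall>e>0. \<exists>d>0. \<forall>h\<in>V. (t, pl u h) \<in> S \<and> na h < d \<longrightarrow>
         ml_norm na nb V j (\<lambda>hs. D j t (pl u h) hs - D j t u hs - D (Suc j) t u (h # hs))
           \<le> e * na h) \<and>
     (\<forall>j\<le>k. \<forall>(t,u)\<in>S. \<forall>e>0. \<exists>d>0. \<forall>s. \<forall>h\<in>V. (s, pl u h) \<in> S \<and> \<bar>s - t\<bar> < d \<and> na h < d \<longrightarrow>
         ml_norm na nb V j (\<lambda>hs. D j s (pl u h) hs - D j t u hs) < e)"

text \<open>C^{0,k}_b(S): continuous, k times continuously Frechet differentiable in the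
  second variable, derivatives of orders 1..k bounded on S.\<close>
definition C0kb ::
  "('a \<Rightarrow> 'a \<Rightarrow> 'a) \<Rightarrow> (real \<Rightarrow> 'a \<Rightarrow> 'a) \<Rightarrow> ('a \<Rightarrow> real) \<Rightarrow> ('b::real_vector \<Rightarrow> real)
    \<Rightarrow> 'a set \<Rightarrow> (real \<times> 'a) set \<Rightarrow> nat \<Rightarrow> (real \<Rightarrow> 'a \<Rightarrow> 'b) \<Rightarrow> bool" where
  "C0kb pl sc na nb V S k F \<longleftrightarrow>
     (\<exists>D. deriv_family pl sc na nb V S F k D \<and>
        (\<forall>j\<in>{1..k}. bdd_above {ml_norm na nb V j (D j t u) | t u. (t,u) \<in> S}))"

text \<open>C^k_b(X, R^q) for maps on an open subset of R^n (max-norm).\<close>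
definition Ckb :: "nat \<Rightarrow> (real^'n) set \<Rightarrow> (real^'n \<Rightarrow> real^'q) \<Rightarrow> bool" where
  "Ckb k X \<Psi> \<longleftrightarrow> C0kb (+) (*\<^sub>R) infnorm infnorm UNIV (UNIV \<times> X) k (\<lambda>_ x. \<Psi> x)"

section \<open>Solutions of the DDE\<close>

text \<open>y is a solution of y' = F(t, y_t), y_{t0} = u on [t0 - tau, t0 + c), c in (0, oo].\<close>
definition dde_solution ::
  "real \<Rightarrow> (real \<Rightarrow> (real \<Rightarrow> real^'m) \<Rightarrow> real^'m) \<Rightarrow> real set \<Rightarrow> (real \<Rightarrow> real^'m) set
    \<Rightarrow> real \<Rightarrow> (real \<Rightarrow> real^'m) \<Rightarrow> (real \<Rightarrow> real^'m) \<Rightarrow> ereal \<Rightarrow> bool" where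
  "dde_solution tau F Ot Oy t0 u y c \<longleftrightarrow>
     c > 0 \<and>
     continuous_on {t. t0 - tau \<le> t \<and> ereal t < ereal t0 + c} y \<and>
     seg tau y t0 = u \<and>
     (\<forall>t. t0 \<le> t \<and> ereal t < ereal t0 + c \<longrightarrow>
        t \<in> Ot \<and> seg tau y t \<in> Oy \<and>
        (y has_vector_derivative F t (seg tau y t)) (at t within {t0..}))"

end

theory Submission
  imports Defs
begin

text \<open>With \<open>m = max n q\<close>, let \<open>W\<close> embed \<open>\<real>\<^sup>n\<close> into \<open>\<real>\<^sup>m\<close> scaled by \<open>w\<close>, let \<open>W'\<close> project
  \<open>\<real>\<^sup>m\<close> onto \<open>\<real>\<^sup>q\<close> scaled by \<open>w'\<close>, and let \<open>P\<close>, \<open>E\<close> be the matrices with \<open>P W = id\<close> and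
  \<open>W' E = id\<close>. Take a continuous bump \<open>\<phi>\<close> supported in \<open>[T - \<tau>, T]\<close> with mass one and
  \<open>sup |\<phi>| = 2/\<tau>\<close>, and the vector field \<open>F(t, u) = \<phi>(t) (E \<Psi>(P u(-\<tau>)) - u(-\<tau>))\<close>.
  Since \<open>\<phi>\<close> vanishes on \<open>[0, T - \<tau>]\<close>, the solution starting at \<open>c\<^bsub>W x\<^esub>\<close> stays at \<open>W x\<close>
  until \<open>T - \<tau>\<close>, so its delayed value is \<open>W x\<close> wherever \<open>\<phi>\<close> is nonzero; there the equation
  reads \<open>y' = \<phi>(t) (E \<Psi>(x) - W x)\<close>, which integrates to \<open>y(T) = E \<Psi>(x)\<close>, i.e.
  \<open>W' y(T) = \<Psi>(x)\<close>. The regularity of \<open>F\<close> is that of \<open>\<Psi>\<close>, transported by the bounded linear map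
  \<open>u \<mapsto> P u(-\<tau>)\<close>. Finally \<open>|F(t, c\<^bsub>W x\<^esub>) - F(t, c\<^bsub>W x'\<^esub>)| \<le> (2/\<tau>) (K\<^sub>\<Psi>/w' + w) |x - x'|\<close>
  while \<open>\<parallel>c\<^bsub>W x\<^esub> - c\<^bsub>W x'\<^esub>\<parallel> = w |x - x'|\<close>, so the hypothesis on \<open>K \<tau>\<close> makes \<open>K\<close> a Lipschitz
  constant on the initial data.\<close>

section \<open>Multilinear maps\<close>

lemma prod_list_map_mono:
  fixes f g :: "'a \<Rightarrow> real"
  assumes "\<And>h. h \<in> set hs \<Longrightarrow> 0 \<le> f h \<and> f h \<le> g h"
  shows "prod_list (map f hs) \<le> prod_list (map g hs)"
  using assms
proof (induction hs)
  case (Cons a hs)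
  have fa: "0 \<le> f a" "f a \<le> g a" and IH: "prod_list (map f hs) \<le> prod_list (map g hs)"
    using Cons by auto
  have "0 \<le> prod_list (map f hs)"
    using Cons.prems by (intro prod_list_nonneg) auto
  then have "f a * prod_list (map f hs) \<le> g a * prod_list (map g hs)"
    using fa by (intro mult_mono[OF fa(2) IH]) auto
  then show ?case by simp
qed simp

lemma prod_list_map_le_one:
  fixes f :: "'a \<Rightarrow> real"
  assumes "\<And>h. h \<in> set hs \<Longrightarrow> 0 \<le> f h \<and> f h \<le> 1"
  shows "prod_list (map f hs) \<le> 1"
  using prod_list_map_mono[of hs f "\<lambda>_. 1"] assms
  by (simp add: prod_list_replicate[of "length hs" 1, symmetric] map_replicate_const)

lemma prod_list_map_const_mult:
  "prod_list (map (\<lambda>h. c * f h) hs) = (c::real) ^ length hs * prod_list (map f hs)"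
  by (induction hs) auto

abbreviation ml_bounded_inf :: "nat \<Rightarrow> ('a::euclidean_space list \<Rightarrow> 'b::euclidean_space) \<Rightarrow> bool" where
  "ml_bounded_inf \<equiv> ml_bounded (+) (*\<^sub>R) infnorm infnorm UNIV"

abbreviation ml_norm_inf :: "nat \<Rightarrow> ('a::euclidean_space list \<Rightarrow> 'b::euclidean_space) \<Rightarrow> real" where
  "ml_norm_inf \<equiv> ml_norm infnorm infnorm UNIV"

lemma ml_boundedI:
  assumes "\<And>hs i h h'. length hs = j \<Longrightarrow> set hs \<subseteq> V \<Longrightarrow> i < j \<Longrightarrow> h \<in> V \<Longrightarrow> h' \<in> V \<Longrightarrow>
      M (hs[i := pl h h']) = M (hs[i := h]) + M (hs[i := h'])"
    and "\<And>hs i h c. length hs = j \<Longrightarrow> set hs \<subseteq> V \<Longrightarrow> i < j \<Longrightarrow> h \<in> V \<Longrightarrow>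
      M (hs[i := sc c h]) = c *\<^sub>R M (hs[i := h])"
    and "\<And>hs. length hs = j \<Longrightarrow> set hs \<subseteq> V \<Longrightarrow> nb (M hs) \<le> B * prod_list (map na hs)"
  shows "ml_bounded pl sc na nb V j M"
  unfolding ml_bounded_def using assms by blast

lemma ml_bounded_add:
  "ml_bounded pl sc na nb V j M \<Longrightarrow> length hs = j \<Longrightarrow> set hs \<subseteq> V \<Longrightarrow> i < j \<Longrightarrow> h \<in> V \<Longrightarrow> h' \<in> V \<Longrightarrow>
    M (hs[i := pl h h']) = M (hs[i := h]) + M (hs[i := h'])"
  unfolding ml_bounded_def by blast

lemma ml_bounded_scale:
  "ml_bounded pl sc na nb V j M \<Longrightarrow> length hs = j \<Longrightarrow> set hs \<subseteq> V \<Longrightarrow> i < j \<Longrightarrow> h \<in> V \<Longrightarrow>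
    M (hs[i := sc c h]) = c *\<^sub>R M (hs[i := h])"
  unfolding ml_bounded_def by blast

lemma ml_boundedE:
  assumes "ml_bounded pl sc na nb V j M"
  obtains B where "\<And>hs. length hs = j \<Longrightarrow> set hs \<subseteq> V \<Longrightarrow> nb (M hs) \<le> B * prod_list (map na hs)"
  using assms unfolding ml_bounded_def by blast

lemma ml_bounded_unit_bound:
  assumes "ml_bounded pl sc na nb V j M" and na_nonneg: "\<forall>h\<in>V. 0 \<le> na h"
  obtains C where "\<And>hs. length hs = j \<Longrightarrow> set hs \<subseteq> V \<Longrightarrow> \<forall>h\<in>set hs. na h \<le> 1 \<Longrightarrow> nb (M hs) \<le> C"
proof -
  obtain B where B: "\<And>hs. length hs = j \<Longrightarrow> set hs \<subseteq> V \<Longrightarrow> nb (M hs) \<le> B * prod_list (map na hs)"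
    using ml_boundedE[OF assms(1)] by blast
  have "nb (M hs) \<le> \<bar>B\<bar>" if "length hs = j" "set hs \<subseteq> V" "\<forall>h\<in>set hs. na h \<le> 1" for hs
  proof -
    have "\<And>h. h \<in> set hs \<Longrightarrow> 0 \<le> na h \<and> na h \<le> 1"
      using that na_nonneg by auto
    then have "0 \<le> prod_list (map na hs)" "prod_list (map na hs) \<le> 1"
      by (auto intro!: prod_list_nonneg prod_list_map_le_one)
    then have "B * prod_list (map na hs) \<le> \<bar>B\<bar>"
      by (metis abs_ge_self abs_ge_zero mult_left_le order_trans mult_right_mono)
    then show ?thesis
      using B[OF that(1,2)] by linarith
  qed
  then show ?thesis using that by blast
qed

lemma ml_norm_least:
  assumes "0 \<le> C"
    and "\<And>hs. length hs = j \<Longrightarrow> set hs \<subseteq> V \<Longrightarrow> \<forall>h\<in>set hs. na h \<le> 1 \<Longrightarrow> nb (M hs) \<le> C"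
  shows "ml_norm na nb V j M \<le> C"
  unfolding ml_norm_def by (rule cSup_least) (auto intro: assms)

lemma ml_norm_set_bdd_above:
  assumes "ml_bounded pl sc na nb V j M" "\<forall>h\<in>V. 0 \<le> na h"
  shows "bdd_above ({0} \<union> {nb (M hs) | hs. length hs = j \<and> set hs \<subseteq> V \<and> (\<forall>h\<in>set hs. na h \<le> 1)})"
proof -
  obtain C where "\<And>hs. length hs = j \<Longrightarrow> set hs \<subseteq> V \<Longrightarrow> \<forall>h\<in>set hs. na h \<le> 1 \<Longrightarrow> nb (M hs) \<le> C"
    using ml_bounded_unit_bound[OF assms] by blast
  then show ?thesis by (intro bdd_aboveI[of _ "max C 0"]) (auto intro: max.coboundedI1)
qed

lemma ml_norm_upper:
  assumes "ml_bounded pl sc na nb V j M" "\<forall>h\<in>V. 0 \<le> na h"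
    and "length hs = j" "set hs \<subseteq> V" "\<forall>h\<in>set hs. na h \<le> 1"
  shows "nb (M hs) \<le> ml_norm na nb V j M"
  unfolding ml_norm_def by (rule cSup_upper[OF _ ml_norm_set_bdd_above[OF assms(1,2)]]) (use assms in auto)

lemma ml_norm_nonneg:
  assumes "ml_bounded pl sc na nb V j M" "\<forall>h\<in>V. 0 \<le> na h"
  shows "0 \<le> ml_norm na nb V j M"
  unfolding ml_norm_def by (rule cSup_upper[OF _ ml_norm_set_bdd_above[OF assms]]) auto

lemma infnorm_diff_le: "infnorm (a - b) \<le> infnorm a + infnorm b"
  using infnorm_triangle[of a "- b"] by (simp add: infnorm_neg)

lemma ml_bounded_diff:
  fixes A B :: "'a list \<Rightarrow> 'b::euclidean_space"
  assumes A: "ml_bounded pl sc na infnorm V j A" and B: "ml_bounded pl sc na infnorm V j B"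
    and na_nonneg: "\<forall>h\<in>V. 0 \<le> na h"
  shows "ml_bounded pl sc na infnorm V j (\<lambda>hs. A hs - B hs)"
proof -
  obtain BA where BA: "\<And>hs. length hs = j \<Longrightarrow> set hs \<subseteq> V \<Longrightarrow> infnorm (A hs) \<le> BA * prod_list (map na hs)"
    using ml_boundedE[OF A] by blast
  obtain BB where BB: "\<And>hs. length hs = j \<Longrightarrow> set hs \<subseteq> V \<Longrightarrow> infnorm (B hs) \<le> BB * prod_list (map na hs)"
    using ml_boundedE[OF B] by blast
  show ?thesis
  proof (rule ml_boundedI)
    fix hs assume hs: "length hs = j" "set hs \<subseteq> V"
    have p: "0 \<le> prod_list (map na hs)"
      using hs na_nonneg by (intro prod_list_nonneg) auto
    have "infnorm (A hs - B hs) \<le> infnorm (A hs) + infnorm (B hs)"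
      by (rule infnorm_diff_le)
    also have "\<dots> \<le> BA * prod_list (map na hs) + BB * prod_list (map na hs)"
      using BA[OF hs] BB[OF hs] by (rule add_mono)
    also have "\<dots> \<le> (\<bar>BA\<bar> + \<bar>BB\<bar>) * prod_list (map na hs)"
      using mult_right_mono[OF abs_ge_self[of BA] p] mult_right_mono[OF abs_ge_self[of BB] p]
      by (simp add: distrib_right)
    finally show "infnorm (A hs - B hs) \<le> (\<bar>BA\<bar> + \<bar>BB\<bar>) * prod_list (map na hs)" .
  qed (simp_all add: ml_bounded_add[OF A] ml_bounded_add[OF B] ml_bounded_scale[OF A] ml_bounded_scale[OF B]
      scaleR_diff_right)
qed

lemma ml_bounded_scaleR:
  fixes A :: "'a list \<Rightarrow> 'b::euclidean_space"
  assumes A: "ml_bounded pl sc na infnorm V j A"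
  shows "ml_bounded pl sc na infnorm V j (\<lambda>hs. c *\<^sub>R A hs)"
proof -
  obtain B where B: "\<And>hs. length hs = j \<Longrightarrow> set hs \<subseteq> V \<Longrightarrow> infnorm (A hs) \<le> B * prod_list (map na hs)"
    using ml_boundedE[OF A] by blast
  show ?thesis
  proof (rule ml_boundedI)
    fix hs assume "length hs = j" "set hs \<subseteq> V"
    then show "infnorm (c *\<^sub>R A hs) \<le> (\<bar>c\<bar> * B) * prod_list (map na hs)"
      using B by (simp add: infnorm_mul mult.assoc mult_left_mono)
  qed (simp_all add: ml_bounded_add[OF A] ml_bounded_scale[OF A] scaleR_add_right)
qed

lemma ml_bounded_matrix_mult:
  fixes A :: "'a list \<Rightarrow> real^'n" and E :: "real^'n^'m"
  assumes A: "ml_bounded pl sc na infnorm V j A" and E: "\<And>z. infnorm (E *v z) \<le> rho * infnorm z"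
  shows "ml_bounded pl sc na infnorm V j (\<lambda>hs. E *v A hs)"
proof -
  obtain B where B: "\<And>hs. length hs = j \<Longrightarrow> set hs \<subseteq> V \<Longrightarrow> infnorm (A hs) \<le> B * prod_list (map na hs)"
    using ml_boundedE[OF A] by blast
  show ?thesis
  proof (rule ml_boundedI)
    fix hs assume hs: "length hs = j" "set hs \<subseteq> V"
    have "infnorm (E *v A hs) \<le> \<bar>rho\<bar> * infnorm (A hs)"
      using E[of "A hs"] infnorm_pos_le[of "A hs"] by (meson abs_ge_self mult_right_mono order_trans)
    also have "\<dots> \<le> \<bar>rho\<bar> * (B * prod_list (map na hs))"
      using B[OF hs] by (simp add: mult_left_mono)
    finally show "infnorm (E *v A hs) \<le> (\<bar>rho\<bar> * B) * prod_list (map na hs)"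
      by (simp add: mult.assoc)
  qed (simp_all add: ml_bounded_add[OF A] ml_bounded_scale[OF A] matrix_vector_right_distrib
      matrix_vector_mult_scaleR)
qed

lemma ml_bounded_pullback:
  fixes M :: "'a::euclidean_space list \<Rightarrow> 'b::euclidean_space"
  assumes M: "ml_bounded_inf j M"
    and L_add: "\<And>h h'. h \<in> V \<Longrightarrow> h' \<in> V \<Longrightarrow> L (pl h h') = L h + L h'"
    and L_scale: "\<And>c h. h \<in> V \<Longrightarrow> L (sc c h) = c *\<^sub>R L h"
    and L_bound: "\<And>h. h \<in> V \<Longrightarrow> infnorm (L h) \<le> r * na h"
  shows "ml_bounded pl sc na infnorm V j (\<lambda>hs. M (map L hs))"
proof -
  obtain B where B: "\<And>gs. length gs = j \<Longrightarrow> set gs \<subseteq> UNIV \<Longrightarrow> infnorm (M gs) \<le> B * prod_list (map infnorm gs)"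
    using ml_boundedE[OF M] by blast
  show ?thesis
  proof (rule ml_boundedI)
    fix hs assume hs: "length hs = j" "set hs \<subseteq> V"
    have "0 \<le> prod_list (map (\<lambda>h. infnorm (L h)) hs)"
      by (intro prod_list_nonneg) (auto simp: infnorm_pos_le)
    then have "infnorm (M (map L hs)) \<le> \<bar>B\<bar> * prod_list (map (\<lambda>h. infnorm (L h)) hs)"
      using B[of "map L hs"] hs(1) by (simp add: comp_def) (meson abs_ge_self mult_right_mono order_trans)
    also have "\<dots> \<le> \<bar>B\<bar> * prod_list (map (\<lambda>h. r * na h) hs)"
      using hs(2) L_bound by (intro mult_left_mono prod_list_map_mono) (auto simp: infnorm_pos_le)
    finally show "infnorm (M (map L hs)) \<le> (\<bar>B\<bar> * r ^ j) * prod_list (map na hs)"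
      using hs(1) by (simp add: prod_list_map_const_mult mult.assoc)
  next
    fix hs i h h' assume "length hs = j" "set hs \<subseteq> V" "i < j" "h \<in> V" "h' \<in> V"
    then show "M (map L (hs[i := pl h h'])) = M (map L (hs[i := h])) + M (map L (hs[i := h']))"
      by (simp add: map_update L_add ml_bounded_add[OF M])
  next
    fix hs i h c assume "length hs = j" "set hs \<subseteq> V" "i < j" "h \<in> V"
    then show "M (map L (hs[i := sc c h])) = c *\<^sub>R M (map L (hs[i := h]))"
      by (simp add: map_update L_scale ml_bounded_scale[OF M])
  qed
qed

lemma ml_bounded_Cons:
  assumes M: "ml_bounded pl sc na nb V (Suc j) M" and g: "g \<in> V"
  shows "ml_bounded pl sc na nb V j (\<lambda>hs. M (g # hs))"
proof -
  obtain B where B: "\<And>hs. length hs = Suc j \<Longrightarrow> set hs \<subseteq> V \<Longrightarrow> nb (M hs) \<le> B * prod_list (map na hs)"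
    using ml_boundedE[OF M] by blast
  show ?thesis
  proof (rule ml_boundedI)
    fix hs assume "length hs = j" "set hs \<subseteq> V"
    then show "nb (M (g # hs)) \<le> (B * na g) * prod_list (map na hs)"
      using B[of "g # hs"] g by (simp add: mult.assoc)
  next
    fix hs i h h' assume "length hs = j" "set hs \<subseteq> V" "i < j" "h \<in> V" "h' \<in> V"
    then show "M (g # hs[i := pl h h']) = M (g # hs[i := h]) + M (g # hs[i := h'])"
      using ml_bounded_add[OF M, of "g # hs" "Suc i"] g by simp
  next
    fix hs i h c assume "length hs = j" "set hs \<subseteq> V" "i < j" "h \<in> V"
    then show "M (g # hs[i := sc c h]) = c *\<^sub>R M (g # hs[i := h])"
      using ml_bounded_scale[OF M, of "g # hs" "Suc i"] g by simp
  qed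
qed

lemma ml_bounded_inf_scale_args:
  assumes "ml_bounded_inf (length hs) M"
  shows "M (map ((*\<^sub>R) c) hs) = c ^ length hs *\<^sub>R M hs"
  using assms
proof (induction hs arbitrary: M)
  case (Cons x xs)
  have "M (map ((*\<^sub>R) c) (x # xs)) = M ((x # map ((*\<^sub>R) c) xs)[0 := c *\<^sub>R x])"
    by simp
  also have "\<dots> = c *\<^sub>R M (x # map ((*\<^sub>R) c) xs)"
    using ml_bounded_scale[OF Cons.prems, of "x # map ((*\<^sub>R) c) xs" 0 x c] by simp
  also have "\<dots> = c *\<^sub>R (c ^ length xs *\<^sub>R M (x # xs))"
    using Cons.IH[OF ml_bounded_Cons[of _ _ _ _ _ "length xs" M x]] Cons.prems by simp
  finally show ?case by simp
qed simp

lemma ml_norm_inf_scaled_bound: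
  assumes M: "ml_bounded_inf j M" and "length gs = j" "\<forall>g\<in>set gs. infnorm g \<le> r" "0 < r"
  shows "infnorm (M gs) \<le> r ^ j * ml_norm_inf j M"
proof -
  define hs where "hs = map ((*\<^sub>R) (1 / r)) gs"
  have len: "length hs = j"
    using assms(2) by (simp add: hs_def)
  have unit: "\<forall>h\<in>set hs. infnorm h \<le> 1"
    using assms(3,4) by (simp add: hs_def infnorm_mul)
  have "M gs = M (map ((*\<^sub>R) r) hs)"
    using assms(4) by (simp add: hs_def comp_def)
  also have "\<dots> = r ^ j *\<^sub>R M hs"
    using ml_bounded_inf_scale_args[of hs M r] M len by simp
  finally have "infnorm (M gs) = r ^ j * infnorm (M hs)"
    using assms(4) by (simp add: infnorm_mul)
  also have "\<dots> \<le> r ^ j * ml_norm_inf j M"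
    using ml_norm_upper[OF M _ len _ unit] assms(4) by (simp add: infnorm_pos_le)
  finally show ?thesis .
qed

section \<open>The phase space\<close>

lemma cnorm_upper:
  assumes "h \<in> Cset tau" "s \<in> {-tau..0}"
  shows "infnorm (h s) \<le> cnorm tau h"
proof -
  have "compact (h ` {-tau..0})"
    using assms(1) by (intro compact_continuous_image) (auto simp: Cset_def)
  then obtain b where "\<forall>x\<in>h ` {-tau..0}. norm x \<le> b"
    using compact_imp_bounded bounded_pos by metis
  then have "bdd_above ((\<lambda>s. infnorm (h s)) ` {-tau..0})"
    by (intro bdd_aboveI[of _ b]) (auto intro: order.trans[OF infnorm_le_norm])
  then show ?thesis
    unfolding cnorm_def by (rule cSUP_upper[OF assms(2)])
qed

lemma cnorm_nonneg: "h \<in> Cset tau \<Longrightarrow> 0 \<le> tau \<Longrightarrow> 0 \<le> cnorm tau h"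
  using cnorm_upper[of h tau 0] infnorm_pos_le[of "h 0"] by auto

lemma Cdiff_in_Cset: "u \<in> Cset tau \<Longrightarrow> v \<in> Cset tau \<Longrightarrow> Cdiff u v \<in> Cset tau"
  by (auto simp: Cset_def Cdiff_def intro!: continuous_intros)

lemma cconst_in_Cset: "cconst tau a \<in> Cset tau"
  by (auto simp: Cset_def cconst_def intro!: continuous_on_eq[OF continuous_on_const[of _ a]])

lemma cnorm_Cdiff_cconst:
  assumes "0 \<le> tau"
  shows "cnorm tau (Cdiff (cconst tau a) (cconst tau b)) = infnorm (a - b)"
proof -
  have "cnorm tau (Cdiff (cconst tau a) (cconst tau b)) = (SUP s\<in>{-tau..0}. infnorm (a - b))"
    unfolding cnorm_def Cdiff_def cconst_def by (intro SUP_cong) auto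
  also have "\<dots> = infnorm (a - b)"
    using assms by (intro cSUP_const) auto
  finally show ?thesis .
qed

section \<open>Max-norm estimates and coordinate embeddings\<close>

lemma dist_le_infnorm: "dist x y \<le> sqrt DIM('a) * infnorm (x - y)" for x y :: "'a::euclidean_space"
  by (simp add: dist_norm norm_le_infnorm)

lemma open_contains_infnorm_ball:
  fixes x :: "'a::euclidean_space"
  assumes "open X" "x \<in> X"
  obtains e where "0 < e" "\<And>y. infnorm (y - x) < e \<Longrightarrow> y \<in> X"
proof -
  obtain d where d: "0 < d" "ball x d \<subseteq> X"
    using assms open_contains_ball by blast
  have inX: "y \<in> X" if "infnorm (y - x) < d / sqrt DIM('a)" for y
  proof -
    have "dist x y < d"
      using dist_le_infnorm[of y x] that by (simp add: field_simps dist_commute)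
    then show ?thesis using d(2) by auto
  qed
  show ?thesis
    by (rule that[of "d / sqrt DIM('a)"]) (use d(1) inX in auto)
qed

lemma continuous_on_infnorm_delta:
  fixes f :: "'a::euclidean_space \<Rightarrow> 'b::euclidean_space"
  assumes "continuous_on X f" "x \<in> X" "0 < e"
  obtains d where "0 < d" "\<And>y. y \<in> X \<Longrightarrow> infnorm (y - x) < d \<Longrightarrow> infnorm (f y - f x) < e"
proof -
  obtain d where d: "0 < d" "\<And>y. y \<in> X \<Longrightarrow> dist y x < d \<Longrightarrow> dist (f y) (f x) < e"
    using assms unfolding continuous_on_iff by metis
  have close: "infnorm (f y - f x) < e" if "y \<in> X" "infnorm (y - x) < d / sqrt DIM('a)" for y
  proof -
    have "dist y x < d"
      using dist_le_infnorm[of y x] that(2) by (simp add: field_simps)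
    then show ?thesis
      using d(2)[OF that(1)] infnorm_le_norm[of "f y - f x"] by (simp add: dist_norm)
  qed
  show ?thesis
    by (rule that[of "d / sqrt DIM('a)"]) (use d(1) close in auto)
qed

definition embed_mat :: "('n \<Rightarrow> 'm) \<Rightarrow> real \<Rightarrow> real^'n^'m" where
  "embed_mat f c = (\<chi> i j. if i = f j then c else 0)"

definition proj_mat :: "('n \<Rightarrow> 'm) \<Rightarrow> real \<Rightarrow> real^'m^'n" where
  "proj_mat f c = (\<chi> j i. if i = f j then c else 0)"

lemma infnorm_le_cart: "(\<And>i. \<bar>x $ i\<bar> \<le> C) \<Longrightarrow> infnorm (x::real^'n) \<le> C"
  unfolding infnorm_cart by (rule cSup_least) auto

lemma embed_mat_apply:
  assumes "inj f"
  shows "(embed_mat f c *v x) $ i = (if i \<in> range f then c * x $ inv f i else 0)"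
proof (cases "i \<in> range f")
  case True
  then obtain j0 where j0: "i = f j0" by auto
  have "(embed_mat f c *v x) $ i = (\<Sum>j\<in>UNIV. (if j = j0 then c * x $ j else 0))"
    unfolding embed_mat_def matrix_vector_mult_def vec_lambda_beta using assms j0
    by (intro sum.cong) (auto simp: inj_eq)
  then show ?thesis using True j0 assms by simp
next
  case False
  then show ?thesis
    unfolding embed_mat_def matrix_vector_mult_def vec_lambda_beta by (auto intro!: sum.neutral)
qed

lemma proj_mat_apply: "(proj_mat f c *v z) $ j = c * z $ f j"
proof -
  have "(proj_mat f c *v z) $ j = (\<Sum>i\<in>UNIV. (if i = f j then c * z $ i else 0))"
    unfolding proj_mat_def matrix_vector_mult_def vec_lambda_beta by (intro sum.cong) auto
  then show ?thesis by simp
qed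

lemma proj_mat_embed_mat: "inj f \<Longrightarrow> proj_mat f d *v (embed_mat f c *v x) = (d * c) *\<^sub>R x"
  by (simp add: vec_eq_iff proj_mat_apply embed_mat_apply)

lemma infnorm_embed_mat:
  assumes "inj f" "0 \<le> c"
  shows "infnorm (embed_mat f c *v x) = c * infnorm x"
proof (rule antisym)
  show "infnorm (embed_mat f c *v x) \<le> c * infnorm x"
    using assms component_le_infnorm_cart[of x] infnorm_pos_le[of x]
    by (intro infnorm_le_cart) (auto simp: embed_mat_apply abs_mult intro: mult_left_mono)
  show "c * infnorm x \<le> infnorm (embed_mat f c *v x)"
  proof (cases "c = 0")
    case False
    then have c: "0 < c" using assms by simp
    have "\<bar>x $ j\<bar> \<le> infnorm (embed_mat f c *v x) / c" for j
      using component_le_infnorm_cart[of "embed_mat f c *v x" "f j"] assms c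
      by (simp add: embed_mat_apply abs_mult field_simps)
    then have "infnorm x \<le> infnorm (embed_mat f c *v x) / c"
      by (rule infnorm_le_cart)
    then show ?thesis using c by (simp add: field_simps)
  qed (simp add: infnorm_pos_le)
qed

lemma infnorm_proj_mat_le: "0 \<le> c \<Longrightarrow> infnorm (proj_mat f c *v z) \<le> c * infnorm z"
  using component_le_infnorm_cart[of z]
  by (intro infnorm_le_cart) (auto simp: proj_mat_apply abs_mult intro: mult_left_mono)

lemma infnorm_const_vec: "0 \<le> c \<Longrightarrow> infnorm ((\<chi> i. c) :: real^'n) = c"
  unfolding infnorm_cart by simp

lemma mat_infnorm_embed_mat:
  assumes "inj f" "0 \<le> c"
  shows "mat_infnorm (embed_mat f c) = c"
  unfolding mat_infnorm_def
proof (rule cSup_eq_maximum)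
  show "c \<in> {infnorm (embed_mat f c *v x) |x. infnorm x = 1}"
    using infnorm_embed_mat[OF assms, of "\<chi> i. 1"] infnorm_const_vec[of 1] by force
qed (use infnorm_embed_mat[OF assms] in auto)

lemma mat_infnorm_proj_mat:
  assumes "0 \<le> c"
  shows "mat_infnorm (proj_mat f c) = c"
  unfolding mat_infnorm_def
proof (rule cSup_eq_maximum)
  have "proj_mat f c *v (\<chi> i. 1) = (\<chi> i. c)"
    by (simp add: vec_eq_iff proj_mat_apply)
  then show "c \<in> {infnorm (proj_mat f c *v x) |x. infnorm x = 1}"
    using assms by (intro CollectI exI[of _ "\<chi> i. 1"]) (simp add: infnorm_const_vec)
next
  fix y assume "y \<in> {infnorm (proj_mat f c *v x) |x. infnorm x = 1}"
  then obtain x where "y = infnorm (proj_mat f c *v x)" "infnorm x = 1"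
    by blast
  then show "y \<le> c"
    using infnorm_proj_mat_le[OF assms, of f x] by simp
qed

section \<open>A bump function\<close>

definition bump :: "real \<Rightarrow> real \<Rightarrow> real \<Rightarrow> real" where
  "bump a tau t = (1 - cos (2 * pi * (max a (min (a + tau) t) - a) / tau)) / tau"

lemma continuous_on_bump: "continuous_on UNIV (bump a tau)"
  unfolding bump_def divide_inverse by (intro continuous_intros)

lemma abs_bump_le: "0 < tau \<Longrightarrow> \<bar>bump a tau t\<bar> \<le> 2 / tau"
  unfolding bump_def using cos_le_one[of "2 * pi * (max a (min (a + tau) t) - a) / tau"]
    cos_ge_minus_one[of "2 * pi * (max a (min (a + tau) t) - a) / tau"]
  by (auto simp: divide_right_mono abs_le_iff)

lemma bump_eq_0:
  assumes "0 < tau" "t \<le> a \<or> a + tau \<le> t"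
  shows "bump a tau t = 0"
proof -
  have "max a (min (a + tau) t) - a = 0 \<or> max a (min (a + tau) t) - a = tau"
    using assms by auto
  then show ?thesis unfolding bump_def using assms(1) by auto
qed

lemma integral_bump_support:
  assumes "0 < tau"
  shows "integral {a..a + tau} (bump a tau) = 1"
proof -
  define A where "A t = (t - a) / tau - sin (2 * pi * (t - a) / tau) / (2 * pi)" for t
  have "(A has_vector_derivative bump a tau t) (at t within {a..a + tau})" if "t \<in> {a..a + tau}" for t
  proof -
    have "(A has_real_derivative (1 / tau - cos (2 * pi * (t - a) / tau) * (2 * pi / tau) / (2 * pi))) (at t)"
      unfolding A_def using assms by (auto intro!: derivative_eq_intros simp: field_simps)
    moreover have "1 / tau - cos (2 * pi * (t - a) / tau) * (2 * pi / tau) / (2 * pi) = bump a tau t"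
      using that assms by (simp add: bump_def field_simps)
    ultimately show ?thesis
      by (simp add: has_real_derivative_iff_has_vector_derivative has_vector_derivative_at_within)
  qed
  then have "(bump a tau has_integral (A (a + tau) - A a)) {a..a + tau}"
    using assms by (intro fundamental_theorem_of_calculus) auto
  moreover have "A (a + tau) - A a = 1"
    unfolding A_def using assms by simp
  ultimately show ?thesis by (simp add: integral_unique)
qed

lemma integral_bump_before:
  assumes "0 < tau" "t \<le> a"
  shows "integral {L..t} (bump a tau) = 0"
proof -
  have "integral {L..t} (bump a tau) = integral {L..t} (\<lambda>_. 0)"
    using assms bump_eq_0[OF assms(1)] by (intro integral_cong) auto
  then show ?thesis by simp
qed

lemma integral_bump_after_support:
  assumes "0 < tau" "L \<le> a"
  shows "integral {L..a + tau} (bump a tau) = 1"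
proof -
  have "bump a tau integrable_on {L..a + tau}"
    by (rule integrable_continuous_real) (use continuous_on_bump continuous_on_subset in blast)
  then have "integral {L..a} (bump a tau) + integral {a..a + tau} (bump a tau) = integral {L..a + tau} (bump a tau)"
    using assms by (intro Henstock_Kurzweil_Integration.integral_combine) auto
  then show ?thesis
    using integral_bump_before[OF assms(1) order_refl] integral_bump_support[OF assms(1)] by simp
qed

lemma integral_bump_has_vector_derivative:
  assumes "L < t"
  shows "((\<lambda>t. integral {L..t} (bump a tau)) has_vector_derivative bump a tau t) (at t)"
proof -
  have "((\<lambda>t. integral {L..t} (bump a tau)) has_vector_derivative bump a tau t) (at t within {L..t + 1})"
    using assms continuous_on_subset[OF continuous_on_bump, of "{L..t + 1}" a tau]
    by (intro integral_has_vector_derivative) auto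
  then have "((\<lambda>t. integral {L..t} (bump a tau)) has_vector_derivative bump a tau t) (at t within {L<..<t + 1})"
    by (rule has_vector_derivative_within_subset) auto
  then show ?thesis
    using at_within_open[of t "{L<..<t + 1}"] assms by auto
qed

section \<open>The delayed vector field and its regularity\<close>

locale delay_field =
  fixes tau r rho phi_max :: real and X :: "(real^'n) set" and k :: nat
    and Psi :: "real^'n \<Rightarrow> real^'q"
    and DP :: "nat \<Rightarrow> real \<Rightarrow> real^'n \<Rightarrow> (real^'n) list \<Rightarrow> real^'q"
    and phi :: "real \<Rightarrow> real" and P :: "real^'m^'n" and E :: "real^'q^'m"
  assumes tau_pos: "0 < tau" and r_pos: "0 < r" and rho_nonneg: "0 \<le> rho"
    and open_X: "open X"
    and DP: "deriv_family (+) (*\<^sub>R) infnorm infnorm UNIV (UNIV \<times> X) (\<lambda>_ x. Psi x) k DP"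
    and DP_bdd: "\<forall>j\<in>{1..k}. bdd_above {ml_norm_inf j (DP j t x) | t x. (t, x) \<in> UNIV \<times> X}"
    and phi_cont: "continuous_on UNIV phi" and phi_bound: "\<And>t. \<bar>phi t\<bar> \<le> phi_max"
    and P_bound: "\<And>z. infnorm (P *v z) \<le> r * infnorm z"
    and E_bound: "\<And>z. infnorm (E *v z) \<le> rho * infnorm z"
begin

abbreviation ml_bounded_C :: "nat \<Rightarrow> ((real \<Rightarrow> real^'m) list \<Rightarrow> 'b::euclidean_space) \<Rightarrow> bool" where
  "ml_bounded_C \<equiv> ml_bounded Cadd Cscale (cnorm tau) infnorm (Cset tau)"

abbreviation ml_norm_C :: "nat \<Rightarrow> ((real \<Rightarrow> real^'m) list \<Rightarrow> 'b::euclidean_space) \<Rightarrow> real" where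
  "ml_norm_C \<equiv> ml_norm (cnorm tau) infnorm (Cset tau)"

definition recover :: "(real \<Rightarrow> real^'m) \<Rightarrow> real^'n" where
  "recover u = P *v u (-tau)"

definition Oy :: "(real \<Rightarrow> real^'m) set" where
  "Oy = {u \<in> Cset tau. recover u \<in> X}"

definition F :: "real \<Rightarrow> (real \<Rightarrow> real^'m) \<Rightarrow> real^'m" where
  "F t u = phi t *\<^sub>R (E *v Psi (recover u) - u (-tau))"

text \<open>\<open>DL\<close> and \<open>DH\<close> are the derivatives of \<open>u \<mapsto> u(-tau)\<close> and \<open>u \<mapsto> E \<Psi>(recover u) - u(-tau)\<close>.
  Since \<open>\<Psi>\<close> does not depend on time, the time slot of its derivative family is frozen at \<open>0\<close>.\<close>

definition DL :: "nat \<Rightarrow> (real \<Rightarrow> real^'m) \<Rightarrow> (real \<Rightarrow> real^'m) list \<Rightarrow> real^'m" where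
  "DL j u hs = (if j = 0 then u (-tau) else if j = 1 then hd hs (-tau) else 0)"

definition DH :: "nat \<Rightarrow> (real \<Rightarrow> real^'m) \<Rightarrow> (real \<Rightarrow> real^'m) list \<Rightarrow> real^'m" where
  "DH j u hs = E *v DP j 0 (recover u) (map recover hs) - DL j u hs"

definition DF :: "nat \<Rightarrow> real \<Rightarrow> (real \<Rightarrow> real^'m) \<Rightarrow> (real \<Rightarrow> real^'m) list \<Rightarrow> real^'m" where
  "DF j t u hs = phi t *\<^sub>R DH j u hs"

lemma DP_zero: "x \<in> X \<Longrightarrow> DP 0 t x [] = Psi x"
  using DP unfolding deriv_family_def by auto

lemma DP_ml_bounded: "j \<le> k \<Longrightarrow> x \<in> X \<Longrightarrow> ml_bounded_inf j (DP j t x)"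
  using DP unfolding deriv_family_def by auto

lemma DP_remainder:
  "j < k \<Longrightarrow> x \<in> X \<Longrightarrow> 0 < e \<Longrightarrow> \<exists>d>0. \<forall>h. x + h \<in> X \<and> infnorm h < d \<longrightarrow>
     ml_norm_inf j (\<lambda>hs. DP j t (x + h) hs - DP j t x hs - DP (Suc j) t x (h # hs)) \<le> e * infnorm h"
  using DP unfolding deriv_family_def by fastforce

lemma DP_continuous:
  "j \<le> k \<Longrightarrow> x \<in> X \<Longrightarrow> 0 < e \<Longrightarrow> \<exists>d>0. \<forall>s h. x + h \<in> X \<and> \<bar>s - t\<bar> < d \<and> infnorm h < d \<longrightarrow>
     ml_norm_inf j (\<lambda>hs. DP j s (x + h) hs - DP j t x hs) < e"
  using DP unfolding deriv_family_def by fastforce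

lemma cnorm_nonneg_Cset: "\<forall>h\<in>Cset tau. 0 \<le> cnorm tau h"
  using tau_pos by (intro ballI cnorm_nonneg) auto

lemma recover_Cadd: "recover (Cadd u h) = recover u + recover h"
  unfolding recover_def Cadd_def by (simp add: matrix_vector_right_distrib)

lemma recover_Cscale: "recover (Cscale c h) = c *\<^sub>R recover h"
  unfolding recover_def Cscale_def by (simp add: matrix_vector_mult_scaleR)

lemma recover_bound: "h \<in> Cset tau \<Longrightarrow> infnorm (recover h) \<le> r * cnorm tau h"
  unfolding recover_def
  using order_trans[OF P_bound mult_left_mono[OF cnorm_upper[of h tau "-tau"]]] tau_pos r_pos
  by simp

lemma open_Oy: "C_open tau Oy"
  unfolding C_open_def
proof (intro conjI ballI)
  show "Oy \<subseteq> Cset tau" by (auto simp: Oy_def)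
  fix u assume u: "u \<in> Oy"
  then obtain e where e: "0 < e" "\<And>y. infnorm (y - recover u) < e \<Longrightarrow> y \<in> X"
    using open_contains_infnorm_ball[OF open_X] by (auto simp: Oy_def)
  have "v \<in> Oy" if v: "v \<in> Cset tau" "cnorm tau (Cdiff v u) < e / r" for v
  proof -
    have "recover v - recover u = recover (Cdiff v u)"
      unfolding recover_def Cdiff_def by (simp add: matrix_vector_mult_diff_distrib)
    moreover have "infnorm (recover (Cdiff v u)) \<le> r * cnorm tau (Cdiff v u)"
      using u v(1) by (intro recover_bound Cdiff_in_Cset) (auto simp: Oy_def)
    moreover have "r * cnorm tau (Cdiff v u) < e"
      using mult_strict_left_mono[OF v(2) r_pos] r_pos by simp
    ultimately show ?thesis
      using e(2) v(1) by (auto simp: Oy_def)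
  qed
  then show "\<exists>e>0. \<forall>v\<in>Cset tau. cnorm tau (Cdiff v u) < e \<longrightarrow> v \<in> Oy"
    using e(1) r_pos by (intro exI[of _ "e / r"]) auto
qed

lemma DL_ml_bounded: "ml_bounded_C j (DL j u)"
proof (rule ml_boundedI)
  fix hs :: "(real \<Rightarrow> real^'m) list" assume hs: "length hs = j" "set hs \<subseteq> Cset tau"
  have "0 \<le> prod_list (map (cnorm tau) hs)"
    using hs(2) cnorm_nonneg_Cset by (intro prod_list_nonneg) auto
  moreover have "infnorm (hd hs (-tau)) \<le> prod_list (map (cnorm tau) hs)" if "j = 1"
    using hs that cnorm_upper[of "hd hs" tau "-tau"] tau_pos by (cases hs) auto
  ultimately show "infnorm (DL j u hs) \<le> (infnorm (u (-tau)) + 1) * prod_list (map (cnorm tau) hs)"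
    using hs(1) infnorm_pos_le[of "u (-tau)"]
    by (auto simp: DL_def infnorm_0 distrib_right add_increasing)
next
  fix hs :: "(real \<Rightarrow> real^'m) list" and i h h'
  assume "length hs = j" "i < j"
  then show "DL j u (hs[i := Cadd h h']) = DL j u (hs[i := h]) + DL j u (hs[i := h'])"
    by (cases hs; cases i) (auto simp: DL_def Cadd_def)
next
  fix hs :: "(real \<Rightarrow> real^'m) list" and i h c
  assume "length hs = j" "i < j"
  then show "DL j u (hs[i := Cscale c h]) = c *\<^sub>R DL j u (hs[i := h])"
    by (cases hs; cases i) (auto simp: DL_def Cscale_def)
qed

lemma DL_unit_bound:
  assumes "length hs = j" "set hs \<subseteq> Cset tau" "\<forall>h\<in>set hs. cnorm tau h \<le> 1"
  shows "infnorm (DL j u hs) \<le> (if j = 0 then infnorm (u (-tau)) else 1)"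
  using assms cnorm_upper[of "hd hs" tau "-tau"] tau_pos
  by (cases hs) (auto simp: DL_def infnorm_0)

lemma DL_Cadd_remainder: "DL j (Cadd u h) hs - DL j u hs - DL (Suc j) u (h # hs) = 0"
  by (simp add: DL_def Cadd_def)

lemma DL_Cadd_diff: "h \<in> Cset tau \<Longrightarrow> infnorm (DL j (Cadd u h) hs - DL j u hs) \<le> cnorm tau h"
  using cnorm_upper[of h tau "-tau"] cnorm_nonneg_Cset tau_pos
  by (auto simp: DL_def Cadd_def infnorm_0)

lemma pullback_unit_bound:
  assumes "ml_bounded_inf j M" "length hs = j" "set hs \<subseteq> Cset tau" "\<forall>h\<in>set hs. cnorm tau h \<le> 1"
  shows "infnorm (E *v M (map recover hs)) \<le> rho * r ^ j * ml_norm_inf j M"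
proof -
  have "infnorm (recover h) \<le> r" if "h \<in> set hs" for h
    using order_trans[OF recover_bound mult_left_le[of "cnorm tau h" r]] assms(3,4) that r_pos
    by (auto simp: less_imp_le)
  then have "infnorm (M (map recover hs)) \<le> r ^ j * ml_norm_inf j M"
    using assms(1,2) r_pos by (intro ml_norm_inf_scaled_bound) simp_all
  then have "rho * infnorm (M (map recover hs)) \<le> rho * (r ^ j * ml_norm_inf j M)"
    using rho_nonneg by (rule mult_left_mono)
  then show ?thesis
    using E_bound[of "M (map recover hs)"] by (simp add: mult.assoc)
qed

lemma DH_ml_bounded:
  assumes "u \<in> Oy" "j \<le> k"
  shows "ml_bounded_C j (DH j u)"
proof -
  have "recover u \<in> X"
    using assms(1) by (simp add: Oy_def)
  then have "ml_bounded_C j (\<lambda>hs. DP j 0 (recover u) (map recover hs))"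
    using assms(2) recover_bound r_pos
    by (intro ml_bounded_pullback DP_ml_bounded) (auto simp: recover_Cadd recover_Cscale)
  then have "ml_bounded_C j (\<lambda>hs. E *v DP j 0 (recover u) (map recover hs) - DL j u hs)"
    using E_bound cnorm_nonneg_Cset by (intro ml_bounded_diff ml_bounded_matrix_mult DL_ml_bounded)
  then show ?thesis
    unfolding DH_def .
qed

lemma DH_unit_bound:
  assumes "u \<in> Oy" "j \<le> k" "length hs = j" "set hs \<subseteq> Cset tau" "\<forall>h\<in>set hs. cnorm tau h \<le> 1"
  shows "infnorm (DH j u hs)
    \<le> rho * r ^ j * ml_norm_inf j (DP j 0 (recover u)) + (if j = 0 then infnorm (u (-tau)) else 1)"
proof -
  have "infnorm (E *v DP j 0 (recover u) (map recover hs)) \<le> rho * r ^ j * ml_norm_inf j (DP j 0 (recover u))"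
    using assms by (intro pullback_unit_bound DP_ml_bounded) (auto simp: Oy_def)
  moreover have "infnorm (DH j u hs) \<le> infnorm (E *v DP j 0 (recover u) (map recover hs)) + infnorm (DL j u hs)"
    unfolding DH_def by (rule infnorm_diff_le)
  ultimately show ?thesis
    using DL_unit_bound[OF assms(3-5), of u] by linarith
qed

lemma DH_Cadd_diff:
  assumes "u \<in> Oy" "Cadd u h \<in> Oy" "h \<in> Cset tau" "j \<le> k"
    and "length hs = j" "set hs \<subseteq> Cset tau" "\<forall>h\<in>set hs. cnorm tau h \<le> 1"
  shows "infnorm (DH j (Cadd u h) hs - DH j u hs)
    \<le> rho * r ^ j * ml_norm_inf j (\<lambda>gs. DP j 0 (recover u + recover h) gs - DP j 0 (recover u) gs)
       + cnorm tau h"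
proof -
  let ?M = "\<lambda>gs. DP j 0 (recover u + recover h) gs - DP j 0 (recover u) gs"
  have X: "recover u \<in> X" "recover u + recover h \<in> X"
    using assms(1,2) by (auto simp: Oy_def recover_Cadd)
  have "ml_bounded_inf j ?M"
    using X assms(4) by (intro ml_bounded_diff DP_ml_bounded) (auto simp: infnorm_pos_le)
  then have B: "infnorm (E *v ?M (map recover hs)) \<le> rho * r ^ j * ml_norm_inf j ?M"
    using assms(5-7) by (rule pullback_unit_bound)
  have "DH j (Cadd u h) hs - DH j u hs = E *v ?M (map recover hs) - (DL j (Cadd u h) hs - DL j u hs)"
    by (simp add: DH_def recover_Cadd matrix_vector_mult_diff_distrib algebra_simps)
  then show ?thesis
    using B infnorm_diff_le[of "E *v ?M (map recover hs)" "DL j (Cadd u h) hs - DL j u hs"]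
      DL_Cadd_diff[OF assms(3), of j u hs]
    by simp
qed

lemma DH_Cadd_remainder:
  assumes "u \<in> Oy" "Cadd u h \<in> Oy" "h \<in> Cset tau" "j < k"
    and "length hs = j" "set hs \<subseteq> Cset tau" "\<forall>h\<in>set hs. cnorm tau h \<le> 1"
  shows "infnorm (DH j (Cadd u h) hs - DH j u hs - DH (Suc j) u (h # hs))
    \<le> rho * r ^ j * ml_norm_inf j (\<lambda>gs. DP j 0 (recover u + recover h) gs - DP j 0 (recover u) gs
         - DP (Suc j) 0 (recover u) (recover h # gs))"
proof -
  let ?M = "\<lambda>gs. DP j 0 (recover u + recover h) gs - DP j 0 (recover u) gs - DP (Suc j) 0 (recover u) (recover h # gs)"
  have X: "recover u \<in> X" "recover u + recover h \<in> X"
    using assms(1,2) by (auto simp: Oy_def recover_Cadd)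
  have "ml_bounded_inf j ?M"
    using X assms(4) by (intro ml_bounded_diff ml_bounded_Cons DP_ml_bounded) (auto simp: infnorm_pos_le)
  then have "infnorm (E *v ?M (map recover hs)) \<le> rho * r ^ j * ml_norm_inf j ?M"
    using assms(5-7) by (rule pullback_unit_bound)
  moreover have "DH j (Cadd u h) hs - DH j u hs - DH (Suc j) u (h # hs) = E *v ?M (map recover hs)"
    using DL_Cadd_remainder[of j u h hs]
    by (simp add: DH_def recover_Cadd matrix_vector_mult_diff_distrib algebra_simps)
  ultimately show ?thesis
    by simp
qed

lemma DF_zero: "u \<in> Oy \<Longrightarrow> DF 0 t u [] = F t u"
  by (simp add: DF_def DH_def DL_def F_def DP_zero Oy_def)

lemma DF_ml_bounded: "u \<in> Oy \<Longrightarrow> j \<le> k \<Longrightarrow> ml_bounded_C j (DF j t u)"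
  unfolding DF_def[abs_def] by (intro ml_bounded_scaleR DH_ml_bounded)

lemma DF_remainder:
  assumes u: "u \<in> Oy" and "j < k" "0 < e"
  shows "\<exists>d>0. \<forall>h\<in>Cset tau. (t, Cadd u h) \<in> UNIV \<times> Oy \<and> cnorm tau h < d \<longrightarrow>
    ml_norm_C j (\<lambda>hs. DF j t (Cadd u h) hs - DF j t u hs - DF (Suc j) t u (h # hs)) \<le> e * cnorm tau h"
proof -
  define A where "A = phi_max * (rho * r ^ j) * r"
  have A: "0 \<le> A"
    using phi_bound[of t] rho_nonneg r_pos by (simp add: A_def)
  define e' where "e' = e / (A + 1)"
  have e': "0 < e'" "A * e' \<le> e"
    using A assms(3) by (auto simp: e'_def field_simps)
  obtain d where d: "0 < d" "\<forall>g. recover u + g \<in> X \<and> infnorm g < d \<longrightarrow>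
      ml_norm_inf j (\<lambda>gs. DP j 0 (recover u + g) gs - DP j 0 (recover u) gs - DP (Suc j) 0 (recover u) (g # gs))
        \<le> e' * infnorm g"
    using DP_remainder[OF assms(2) _ e'(1), of "recover u" 0] u by (auto simp: Oy_def)
  have "ml_norm_C j (\<lambda>hs. DF j t (Cadd u h) hs - DF j t u hs - DF (Suc j) t u (h # hs)) \<le> e * cnorm tau h"
    if h: "h \<in> Cset tau" "Cadd u h \<in> Oy" "cnorm tau h < d / r" for h
  proof (rule ml_norm_least)
    have c: "0 \<le> cnorm tau h"
      using h(1) cnorm_nonneg_Cset by blast
    have g: "infnorm (recover h) \<le> r * cnorm tau h"
      by (rule recover_bound[OF h(1)])
    also have "\<dots> < d"
      using h(3) r_pos by (simp add: pos_less_divide_eq mult.commute)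
    finally have "ml_norm_inf j (\<lambda>gs. DP j 0 (recover u + recover h) gs - DP j 0 (recover u) gs
        - DP (Suc j) 0 (recover u) (recover h # gs)) \<le> e' * infnorm (recover h)"
      using d(2) h(2) by (simp add: Oy_def recover_Cadd)
    also have "\<dots> \<le> e' * (r * cnorm tau h)"
      using g e'(1) by (simp add: mult_left_mono)
    finally have R: "rho * r ^ j * ml_norm_inf j (\<lambda>gs. DP j 0 (recover u + recover h) gs - DP j 0 (recover u) gs
        - DP (Suc j) 0 (recover u) (recover h # gs)) \<le> rho * r ^ j * (e' * (r * cnorm tau h))"
      using rho_nonneg r_pos by (simp add: mult_left_mono)
    show "0 \<le> e * cnorm tau h"
      using c assms(3) by simp
    fix hs :: "(real \<Rightarrow> real^'m) list"
    assume hs: "length hs = j" "set hs \<subseteq> Cset tau" "\<forall>h\<in>set hs. cnorm tau h \<le> 1"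
    have "infnorm (DF j t (Cadd u h) hs - DF j t u hs - DF (Suc j) t u (h # hs))
        = \<bar>phi t\<bar> * infnorm (DH j (Cadd u h) hs - DH j u hs - DH (Suc j) u (h # hs))"
      by (simp add: DF_def infnorm_mul flip: scaleR_diff_right)
    also have "\<dots> \<le> phi_max * (rho * r ^ j * (e' * (r * cnorm tau h)))"
      using DH_Cadd_remainder[OF u h(2,1) assms(2) hs] R phi_bound[of t]
      by (intro mult_mono) (auto simp: infnorm_pos_le)
    also have "\<dots> = (A * e') * cnorm tau h"
      by (simp add: A_def ac_simps)
    also have "\<dots> \<le> e * cnorm tau h"
      using e'(2) c by (rule mult_right_mono)
    finally show "infnorm (DF j t (Cadd u h) hs - DF j t u hs - DF (Suc j) t u (h # hs)) \<le> e * cnorm tau h" .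
  qed
  then show ?thesis
    using d(1) r_pos by (intro exI[of _ "d / r"]) auto
qed

lemma phi_max_nonneg: "0 \<le> phi_max"
  using phi_bound[of 0] by linarith

lemma DF_Cadd_diff:
  assumes "u \<in> Oy" "Cadd u h \<in> Oy" "h \<in> Cset tau" "j \<le> k"
    and hs: "length hs = j" "set hs \<subseteq> Cset tau" "\<forall>h\<in>set hs. cnorm tau h \<le> 1"
  shows "infnorm (DF j s (Cadd u h) hs - DF j t u hs)
    \<le> phi_max * (rho * r ^ j * ml_norm_inf j (\<lambda>gs. DP j 0 (recover u + recover h) gs - DP j 0 (recover u) gs)
         + cnorm tau h)
      + \<bar>phi s - phi t\<bar> * (rho * r ^ j * ml_norm_inf j (DP j 0 (recover u)) + infnorm (u (-tau)) + 1)"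
proof -
  have "DF j s (Cadd u h) hs - DF j t u hs
      = phi s *\<^sub>R (DH j (Cadd u h) hs - DH j u hs) + (phi s - phi t) *\<^sub>R DH j u hs"
    by (simp add: DF_def algebra_simps)
  moreover have "infnorm (phi s *\<^sub>R (DH j (Cadd u h) hs - DH j u hs))
      \<le> phi_max * (rho * r ^ j * ml_norm_inf j (\<lambda>gs. DP j 0 (recover u + recover h) gs - DP j 0 (recover u) gs)
         + cnorm tau h)"
    unfolding infnorm_mul using DH_Cadd_diff[OF assms] phi_bound[of s]
    by (intro mult_mono) (auto simp: infnorm_pos_le)
  moreover have "infnorm ((phi s - phi t) *\<^sub>R DH j u hs)
      \<le> \<bar>phi s - phi t\<bar> * (rho * r ^ j * ml_norm_inf j (DP j 0 (recover u)) + infnorm (u (-tau)) + 1)"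
    unfolding infnorm_mul using DH_unit_bound[OF assms(1,4) hs] infnorm_pos_le[of "u (-tau)"]
    by (intro mult_left_mono) (auto split: if_splits)
  ultimately show ?thesis
    using infnorm_triangle[of "phi s *\<^sub>R (DH j (Cadd u h) hs - DH j u hs)" "(phi s - phi t) *\<^sub>R DH j u hs"]
    by simp
qed

lemma DF_continuous:
  assumes u: "u \<in> Oy" and j: "j \<le> k" and e: "0 < e"
  shows "\<exists>d>0. \<forall>s. \<forall>h\<in>Cset tau. (s, Cadd u h) \<in> UNIV \<times> Oy \<and> \<bar>s - t\<bar> < d \<and> cnorm tau h < d \<longrightarrow>
     ml_norm_C j (\<lambda>hs. DF j s (Cadd u h) hs - DF j t u hs) < e"
proof -
  have x: "recover u \<in> X"
    using u by (simp add: Oy_def)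
  define B where "B = rho * r ^ j * ml_norm_inf j (DP j 0 (recover u)) + infnorm (u (-tau)) + 1"
  have "0 \<le> ml_norm_inf j (DP j 0 (recover u))"
    by (rule ml_norm_nonneg[OF DP_ml_bounded[OF j x]]) (simp add: infnorm_pos_le)
  then have "0 \<le> rho * r ^ j * ml_norm_inf j (DP j 0 (recover u))"
    using rho_nonneg r_pos by simp
  then have B: "0 < B"
    using infnorm_pos_le[of "u (-tau)"] unfolding B_def by linarith
  define c where "c = rho * r ^ j + 1"
  define p where "p = phi_max + 1"
  define eta where "eta = e / (4 * p * c)"
  have c: "0 < c"
    using rho_nonneg r_pos by (simp add: c_def add_nonneg_pos)
  have p: "0 < p"
    using phi_max_nonneg by (simp add: p_def)
  have eta0: "0 < eta"
    unfolding eta_def using e c p by simp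
  have "phi_max * (rho * r ^ j * eta + eta) = phi_max * (c * eta)"
    by (simp add: c_def algebra_simps)
  also have "\<dots> \<le> p * (c * eta)"
    using c eta0 by (intro mult_right_mono) (auto simp: p_def)
  also have "\<dots> = e / 4"
    unfolding eta_def using c p by (simp add: field_simps)
  finally have eta: "0 < eta" "phi_max * (rho * r ^ j * eta + eta) \<le> e / 4"
    using eta0 by auto
  obtain d1 where d1: "0 < d1" "\<forall>g. recover u + g \<in> X \<and> infnorm g < d1 \<longrightarrow>
      ml_norm_inf j (\<lambda>gs. DP j 0 (recover u + g) gs - DP j 0 (recover u) gs) < eta"
    using DP_continuous[OF j x eta(1), of 0] by auto
  have "0 < e / (2 * B)"
    using e B by simp
  then obtain d2 where d2: "0 < d2" "\<forall>s. \<bar>s - t\<bar> < d2 \<longrightarrow> \<bar>phi s - phi t\<bar> < e / (2 * B)"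
    using phi_cont unfolding continuous_on_iff dist_real_def by (metis UNIV_I)
  have bound: "ml_norm_C j (\<lambda>hs. DF j s (Cadd u h) hs - DF j t u hs) \<le> 3 * e / 4"
    if h: "h \<in> Cset tau" "Cadd u h \<in> Oy" and s: "\<bar>s - t\<bar> < d2" and small: "cnorm tau h < d1 / r" "cnorm tau h < eta"
    for s h
  proof (rule ml_norm_least)
    have "infnorm (recover h) < d1"
      using recover_bound[OF h(1)] small(1) r_pos by (simp add: pos_less_divide_eq mult.commute)
    then have M: "ml_norm_inf j (\<lambda>gs. DP j 0 (recover u + recover h) gs - DP j 0 (recover u) gs) < eta"
      using d1(2) h(2) by (simp add: Oy_def recover_Cadd)
    have "\<bar>phi s - phi t\<bar> * B \<le> e / (2 * B) * B"
      using d2(2) s B by (intro mult_right_mono) auto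
    then have P: "\<bar>phi s - phi t\<bar> * B \<le> e / 2"
      using B by simp
    show "0 \<le> 3 * e / 4" using e by simp
    fix hs :: "(real \<Rightarrow> real^'m) list"
    assume hs: "length hs = j" "set hs \<subseteq> Cset tau" "\<forall>h\<in>set hs. cnorm tau h \<le> 1"
    have "rho * r ^ j * ml_norm_inf j (\<lambda>gs. DP j 0 (recover u + recover h) gs - DP j 0 (recover u) gs)
        + cnorm tau h \<le> rho * r ^ j * eta + eta"
      using M small(2) rho_nonneg r_pos by (intro add_mono mult_left_mono) auto
    then have "phi_max * (rho * r ^ j * ml_norm_inf j (\<lambda>gs. DP j 0 (recover u + recover h) gs - DP j 0 (recover u) gs)
        + cnorm tau h) \<le> e / 4"
      using eta(2) phi_max_nonneg by (meson mult_left_mono order_trans)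
    then show "infnorm (DF j s (Cadd u h) hs - DF j t u hs) \<le> 3 * e / 4"
      using DF_Cadd_diff[OF u h(2,1) j hs, of s t] P unfolding B_def by linarith
  qed
  show ?thesis
  proof (intro exI[of _ "min (d1 / r) (min d2 eta)"] conjI allI ballI impI)
    show "0 < min (d1 / r) (min d2 eta)"
      using d1(1) d2(1) eta(1) r_pos by simp
    fix s h assume "h \<in> Cset tau"
      "(s, Cadd u h) \<in> UNIV \<times> Oy \<and> \<bar>s - t\<bar> < min (d1 / r) (min d2 eta) \<and> cnorm tau h < min (d1 / r) (min d2 eta)"
    then have "ml_norm_C j (\<lambda>hs. DF j s (Cadd u h) hs - DF j t u hs) \<le> 3 * e / 4"
      by (intro bound) auto
    then show "ml_norm_C j (\<lambda>hs. DF j s (Cadd u h) hs - DF j t u hs) < e"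
      using e by linarith
  qed
qed

lemma DF_bounded:
  assumes "j \<in> {1..k}"
  shows "bdd_above {ml_norm_C j (DF j t u) | t u. (t, u) \<in> UNIV \<times> Oy}"
proof -
  obtain BP where BP: "\<And>t x. x \<in> X \<Longrightarrow> ml_norm_inf j (DP j t x) \<le> BP"
    using DP_bdd assms unfolding bdd_above_def by blast
  have "ml_norm_C j (DF j t u) \<le> phi_max * (rho * r ^ j * max BP 0 + 1)" if u: "u \<in> Oy" for t u
  proof (rule ml_norm_least)
    show "0 \<le> phi_max * (rho * r ^ j * max BP 0 + 1)"
      using phi_max_nonneg rho_nonneg r_pos by simp
    fix hs :: "(real \<Rightarrow> real^'m) list"
    assume hs: "length hs = j" "set hs \<subseteq> Cset tau" "\<forall>h\<in>set hs. cnorm tau h \<le> 1"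
    have "rho * r ^ j * ml_norm_inf j (DP j 0 (recover u)) \<le> rho * r ^ j * max BP 0"
      using BP[of "recover u" 0] u rho_nonneg r_pos by (intro mult_left_mono) (auto simp: Oy_def)
    then have "infnorm (DH j u hs) \<le> rho * r ^ j * max BP 0 + 1"
      using DH_unit_bound[OF u _ hs] assms by auto
    then show "infnorm (DF j t u hs) \<le> phi_max * (rho * r ^ j * max BP 0 + 1)"
      unfolding DF_def infnorm_mul using phi_bound[of t] by (intro mult_mono) (auto simp: infnorm_pos_le)
  qed
  then show ?thesis
    by (intro bdd_aboveI[of _ "phi_max * (rho * r ^ j * max BP 0 + 1)"]) auto
qed

theorem F_C0kb: "C0kb Cadd Cscale (cnorm tau) infnorm (Cset tau) (UNIV \<times> Oy) k F"
  unfolding C0kb_def deriv_family_def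
proof (intro exI[of _ DF] conjI)
  show "\<forall>(t, u)\<in>UNIV \<times> Oy. DF 0 t u [] = F t u"
    by (auto simp: DF_zero)
  show "\<forall>j\<le>k. \<forall>(t, u)\<in>UNIV \<times> Oy. ml_bounded_C j (DF j t u)"
    by (auto intro: DF_ml_bounded)
  show "\<forall>j<k. \<forall>(t, u)\<in>UNIV \<times> Oy. \<forall>e>0. \<exists>d>0. \<forall>h\<in>Cset tau. (t, Cadd u h) \<in> UNIV \<times> Oy \<and> cnorm tau h < d \<longrightarrow>
      ml_norm_C j (\<lambda>hs. DF j t (Cadd u h) hs - DF j t u hs - DF (Suc j) t u (h # hs)) \<le> e * cnorm tau h"
    by (clarify, rule DF_remainder) auto
  show "\<forall>j\<le>k. \<forall>(t, u)\<in>UNIV \<times> Oy. \<forall>e>0. \<exists>d>0. \<forall>s. \<forall>h\<in>Cset tau. (s, Cadd u h) \<in> UNIV \<times> Oy \<and> \<bar>s - t\<bar> < d \<and> cnorm tau h < d \<longrightarrow>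
      ml_norm_C j (\<lambda>hs. DF j s (Cadd u h) hs - DF j t u hs) < e"
    by (clarify, rule DF_continuous) auto
  show "\<forall>j\<in>{1..k}. bdd_above {ml_norm_C j (DF j t u) | t u. (t, u) \<in> UNIV \<times> Oy}"
    by (intro ballI DF_bounded)
qed

end

section \<open>The construction\<close>

lemma deriv_family_order_zero:
  fixes Psi :: "'a::euclidean_space \<Rightarrow> 'b::euclidean_space"
  assumes "continuous_on X Psi"
  shows "deriv_family (+) (*\<^sub>R) infnorm infnorm UNIV (UNIV \<times> X) (\<lambda>_ x. Psi x) 0 (\<lambda>j t x hs. Psi x)"
proof -
  have cont: "\<exists>d>0. \<forall>s. \<forall>h\<in>UNIV. (s, x + h) \<in> UNIV \<times> X \<and> \<bar>s - t\<bar> < d \<and> infnorm h < d \<longrightarrow>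
      ml_norm_inf j (\<lambda>hs::'a list. Psi (x + h) - Psi x) < e"
    if x: "x \<in> X" and e: "0 < e" for j t x e
  proof -
    obtain d where d: "0 < d" "\<And>y. y \<in> X \<Longrightarrow> infnorm (y - x) < d \<Longrightarrow> infnorm (Psi y - Psi x) < e / 2"
      using continuous_on_infnorm_delta[OF assms x, of "e / 2"] e by auto
    have "ml_norm_inf j (\<lambda>hs::'a list. Psi (x + h) - Psi x) \<le> e / 2" if "x + h \<in> X" "infnorm h < d" for h
      using d(2)[of "x + h"] that e by (intro ml_norm_least) auto
    then show ?thesis
      using d(1) e by (intro exI[of _ d]) force
  qed
  show ?thesis
    unfolding deriv_family_def
  proof (intro conjI)
    show "\<forall>(t, x)\<in>UNIV \<times> X. Psi x = Psi x" by simp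
    show "\<forall>j\<le>0. \<forall>(t, x)\<in>UNIV \<times> X. ml_bounded_inf j (\<lambda>hs::'a list. Psi x)"
      by (auto intro!: ml_boundedI[where B = "infnorm (Psi _)"])
    show "\<forall>j<0. P j" for P :: "nat \<Rightarrow> bool" by simp
    show "\<forall>j\<le>0. \<forall>(t, x)\<in>UNIV \<times> X. \<forall>e>0. \<exists>d>0. \<forall>s. \<forall>h\<in>UNIV. (s, x + h) \<in> UNIV \<times> X \<and> \<bar>s - t\<bar> < d \<and> infnorm h < d \<longrightarrow>
        ml_norm_inf j (\<lambda>hs::'a list. Psi (x + h) - Psi x) < e"
      by (clarify, rule cont) auto
  qed
qed

lemma regular_map_deriv_family:
  fixes Psi :: "real^'n \<Rightarrow> real^'q"
  assumes "if k = 0 then continuous_on X Psi else Ckb k X Psi"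
  obtains DP where "deriv_family (+) (*\<^sub>R) infnorm infnorm UNIV (UNIV \<times> X) (\<lambda>_ x. Psi x) k DP"
    and "\<forall>j\<in>{1..k}. bdd_above {ml_norm_inf j (DP j t x) | t x. (t, x) \<in> UNIV \<times> X}"
proof (cases "k = 0")
  case True
  then show ?thesis
    using that deriv_family_order_zero[of X Psi] assms by auto
next
  case False
  then show ?thesis
    using that assms unfolding Ckb_def C0kb_def by auto
qed

lemma eq_if_zero_vector_derivative:
  assumes "a \<le> b" "\<And>r. r \<in> {a..b} \<Longrightarrow> (f has_vector_derivative 0) (at r within {a..b})"
  shows "f b = f a"
proof -
  obtain c where "\<And>r. r \<in> {a..b} \<Longrightarrow> f r = c"
    using has_vector_derivative_zero_constant[of "{a..b}" f] assms(2) by auto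
  then show ?thesis using assms(1) by auto
qed

lemma dde_solution_from_0:
  assumes "dde_solution tau F Ot Oy 0 u y c"
  shows "seg tau y 0 = u"
    and "\<And>t. 0 \<le> t \<Longrightarrow> ereal t < c \<Longrightarrow> (y has_vector_derivative F t (seg tau y t)) (at t within {0..})"
  using assms unfolding dde_solution_def by (auto simp flip: zero_ereal_def)

locale ndde_construction =
  fixes tau T w w' :: real and X :: "(real^'n) set" and k :: nat
    and Psi :: "real^'n \<Rightarrow> real^'q"
    and DP :: "nat \<Rightarrow> real \<Rightarrow> real^'n \<Rightarrow> (real^'n) list \<Rightarrow> real^'q"
    and iota :: "'n \<Rightarrow> 'm::finite" and kappa :: "'q \<Rightarrow> 'm"
  assumes tau: "0 < tau" "tau \<le> T" and w: "0 < w" "0 < w'"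
    and inj_iota: "inj iota" and inj_kappa: "inj kappa"
    and open_X: "open X"
    and DP: "deriv_family (+) (*\<^sub>R) infnorm infnorm UNIV (UNIV \<times> X) (\<lambda>_ x. Psi x) k DP"
    and DP_bdd: "\<forall>j\<in>{1..k}. bdd_above {ml_norm_inf j (DP j t x) | t x. (t, x) \<in> UNIV \<times> X}"

sublocale ndde_construction \<subseteq> delay_field tau "1 / w" "1 / w'" "2 / tau" X k Psi DP "bump (T - tau) tau"
  "proj_mat iota (1 / w)" "embed_mat kappa (1 / w')"
  using tau w open_X DP DP_bdd continuous_on_bump abs_bump_le infnorm_proj_mat_le[of "1 / w" iota]
    infnorm_embed_mat[OF inj_kappa, of "1 / w'"]
  by unfold_locales auto

context ndde_construction
begin

abbreviation W :: "real^'n^'m" where "W \<equiv> embed_mat iota w"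

abbreviation W' :: "real^'m^'q" where "W' \<equiv> proj_mat kappa w'"

text \<open>Any lower limit below \<open>-tau\<close> would do: it only has to make \<open>Phi\<close> differentiable on all of
  \<open>[-tau, \<infinity>)\<close>.\<close>

definition Phi :: "real \<Rightarrow> real" where
  "Phi t = integral {-tau - 1..t} (bump (T - tau) tau)"

definition G :: "real^'n \<Rightarrow> real^'m" where
  "G x = embed_mat kappa (1 / w') *v Psi x - W *v x"

definition solution :: "real^'n \<Rightarrow> real \<Rightarrow> real^'m" where
  "solution x t = W *v x + Phi t *\<^sub>R G x"

lemma recover_W: "proj_mat iota (1 / w) *v (W *v x) = x"
  using proj_mat_embed_mat[OF inj_iota] w by simp

lemma W'_embed_mat: "W' *v (embed_mat kappa (1 / w') *v v) = v"
  using proj_mat_embed_mat[OF inj_kappa] w by simp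

lemma Phi_has_derivative: "-tau - 1 < t \<Longrightarrow> (Phi has_vector_derivative bump (T - tau) tau t) (at t)"
  unfolding Phi_def[abs_def] by (rule integral_bump_has_vector_derivative)

lemma Phi_eq_0: "t \<le> T - tau \<Longrightarrow> Phi t = 0"
  unfolding Phi_def using integral_bump_before[OF tau(1)] by blast

lemma Phi_T: "Phi T = 1"
  unfolding Phi_def using integral_bump_after_support[OF tau(1), of "-tau - 1" "T - tau"] tau by simp

lemma solution_has_derivative:
  assumes "-tau - 1 < t"
  shows "(solution x has_vector_derivative bump (T - tau) tau t *\<^sub>R G x) (at t)"
proof -
  have "(Phi has_field_derivative bump (T - tau) tau t) (at t)"
    using Phi_has_derivative[OF assms] by (simp add: has_real_derivative_iff_has_vector_derivative)
  then have "((\<lambda>t. W *v x + Phi t *\<^sub>R G x) has_vector_derivative 0 + (Phi t *\<^sub>R 0 + bump (T - tau) tau t *\<^sub>R G x)) (at t)"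
    by (intro has_vector_derivative_add has_vector_derivative_scaleR has_vector_derivative_const)
  then show ?thesis
    unfolding solution_def[abs_def] by simp
qed

lemma continuous_on_solution: "continuous_on {-tau - 1<..} (solution x)"
  by (intro continuous_at_imp_continuous_on ballI has_vector_derivative_continuous[OF solution_has_derivative])
    auto

lemma solution_before: "t \<le> T - tau \<Longrightarrow> solution x t = W *v x"
  by (simp add: solution_def Phi_eq_0)

lemma F_eq_G:
  assumes "x \<in> X" "T - tau < t \<Longrightarrow> t < T \<Longrightarrow> y (t - tau) = W *v x"
  shows "F t (seg tau y t) = bump (T - tau) tau t *\<^sub>R G x"
proof (cases "bump (T - tau) tau t = 0")
  case False
  then have "T - tau < t" "t < T"
    using bump_eq_0[OF tau(1), of t "T - tau"] by force+
  then have "seg tau y t (-tau) = W *v x"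
    using assms(2) tau(1) by (simp add: seg_def)
  then show ?thesis
    using DP_zero[OF assms(1)] by (simp add: F_def recover_def recover_W G_def)
qed (simp add: F_def)

lemma seg_solution_in_Cset:
  assumes "0 \<le> t"
  shows "seg tau (solution x) t \<in> Cset tau"
proof -
  have "continuous_on {-tau..0} (\<lambda>s. solution x (t + s))"
    using assms by (intro continuous_on_compose2[OF continuous_on_solution]) (auto intro!: continuous_intros)
  then have "continuous_on {-tau..0} (seg tau (solution x) t)"
    by (rule continuous_on_eq) (auto simp: seg_def)
  then show ?thesis
    by (auto simp: Cset_def seg_def)
qed

lemma seg_solution_in_Oy:
  assumes x: "x \<in> X"
  obtains delta where "0 < delta" "\<And>t. 0 \<le> t \<Longrightarrow> t < T + delta \<Longrightarrow> seg tau (solution x) t \<in> Oy"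
proof -
  define v where "v = proj_mat iota (1 / w) *v G x"
  have recover_seg: "recover (seg tau (solution x) t) = x + Phi (t - tau) *\<^sub>R v" for t
    using tau(1) by (simp add: recover_def v_def seg_def solution_def recover_W
        matrix_vector_right_distrib matrix_vector_mult_scaleR)
  define S where "S = (\<lambda>s. x + Phi s *\<^sub>R v) -` X \<inter> {-tau - 1<..}"
  have "continuous_on {-tau - 1<..} Phi"
    by (intro continuous_at_imp_continuous_on ballI has_vector_derivative_continuous[OF Phi_has_derivative])
      auto
  then have "continuous_on {-tau - 1<..} (\<lambda>s. x + Phi s *\<^sub>R v)"
    by (intro continuous_intros)
  then have "open S"
    unfolding S_def using open_X by (simp add: continuous_on_open_vimage)
  moreover have "T - tau \<in> S"
    using x tau by (simp add: S_def Phi_eq_0)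
  ultimately obtain delta where delta: "0 < delta" "ball (T - tau) delta \<subseteq> S"
    using open_contains_ball by blast
  have "recover (seg tau (solution x) t) \<in> X" if "t < T + delta" for t
  proof (cases "t \<le> T")
    case True
    then show ?thesis using x by (simp add: recover_seg Phi_eq_0)
  next
    case False
    then have "t - tau \<in> ball (T - tau) delta"
      using that by (simp add: dist_real_def)
    then show ?thesis
      using delta(2) by (auto simp: recover_seg S_def)
  qed
  then show ?thesis
    using that delta(1) seg_solution_in_Cset by (auto simp: Oy_def)
qed

lemma dde_solution_solution:
  assumes x: "x \<in> X"
  shows "\<exists>c. dde_solution tau F UNIV Oy 0 (cconst tau (W *v x)) (solution x) c \<and> ereal T < c"
proof -
  obtain delta where delta: "0 < delta" "\<And>t. 0 \<le> t \<Longrightarrow> t < T + delta \<Longrightarrow> seg tau (solution x) t \<in> Oy"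
    using seg_solution_in_Oy[OF x] by blast
  have "seg tau (solution x) 0 = cconst tau (W *v x)"
    using tau by (auto simp: seg_def cconst_def solution_before)
  moreover have "(solution x has_vector_derivative F t (seg tau (solution x) t)) (at t within {0..})"
    if "0 \<le> t" for t
  proof -
    have "F t (seg tau (solution x) t) = bump (T - tau) tau t *\<^sub>R G x"
      using x by (rule F_eq_G) (simp add: solution_before)
    then show ?thesis
      using solution_has_derivative[of t x] that tau(1) by (simp add: has_vector_derivative_at_within)
  qed
  moreover have "continuous_on {t. 0 - tau \<le> t \<and> ereal t < ereal 0 + ereal (T + delta)} (solution x)"
    using tau(1) by (intro continuous_on_subset[OF continuous_on_solution]) auto
  ultimately have "dde_solution tau F UNIV Oy 0 (cconst tau (W *v x)) (solution x) (ereal (T + delta))"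
    unfolding dde_solution_def using delta tau by simp
  then show ?thesis
    using delta(1) by (intro exI[of _ "ereal (T + delta)"]) simp
qed

lemma dde_solution_initial_phase:
  assumes sol: "dde_solution tau F UNIV Oy 0 (cconst tau (W *v x)) y c"
    and s: "-tau \<le> s" "s \<le> T - tau" "ereal s < c"
  shows "y s = W *v x"
proof -
  have init: "y r = W *v x" if "-tau \<le> r" "r \<le> 0" for r
    using fun_cong[OF dde_solution_from_0(1)[OF sol], of r] that by (simp add: seg_def cconst_def)
  show ?thesis
  proof (cases "s \<le> 0")
    case False
    have "y s = y 0"
    proof (rule eq_if_zero_vector_derivative)
      fix r assume r: "r \<in> {0..s}"
      then have "ereal r < c"
        using order_le_less_trans[of "ereal r" "ereal s" c] s(3) by simp
      then have "(y has_vector_derivative F r (seg tau y r)) (at r within {0..})"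
        using dde_solution_from_0(2)[OF sol] r by simp
      moreover have "F r (seg tau y r) = 0"
        using r s(2) bump_eq_0[OF tau(1)] by (simp add: F_def)
      ultimately show "(y has_vector_derivative 0) (at r within {0..s})"
        by (auto intro: has_vector_derivative_within_subset)
    qed (use False in simp)
    then show ?thesis using init[of 0] tau by simp
  qed (use init s in simp)
qed

lemma dde_solution_unique:
  assumes x: "x \<in> X" and sol: "dde_solution tau F UNIV Oy 0 (cconst tau (W *v x)) y c"
    and t: "-tau \<le> t" "ereal t < c"
  shows "y t = solution x t"
proof (cases "t \<le> 0")
  case True
  then show ?thesis
    using dde_solution_initial_phase[OF sol t(1) _ t(2)] tau by (simp add: solution_before)
next
  case False
  have "y t - solution x t = y 0 - solution x 0"
  proof (rule eq_if_zero_vector_derivative)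
    fix r assume r: "r \<in> {0..t}"
    then have rc: "ereal r < c"
      using order_le_less_trans[of "ereal r" "ereal t" c] t(2) by simp
    have "F r (seg tau y r) = bump (T - tau) tau r *\<^sub>R G x"
    proof (rule F_eq_G[OF x])
      assume "r < T"
      moreover have "ereal (r - tau) < c"
        using order_le_less_trans[of "ereal (r - tau)" "ereal r" c] rc tau(1) by simp
      ultimately show "y (r - tau) = W *v x"
        using r by (intro dde_solution_initial_phase[OF sol]) auto
    qed
    moreover have "(y has_vector_derivative F r (seg tau y r)) (at r within {0..})"
      using dde_solution_from_0(2)[OF sol] r rc by simp
    ultimately have "(y has_vector_derivative bump (T - tau) tau r *\<^sub>R G x) (at r within {0..t})"
      by (auto intro: has_vector_derivative_within_subset)
    moreover have "(solution x has_vector_derivative bump (T - tau) tau r *\<^sub>R G x) (at r within {0..t})"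
      using solution_has_derivative[of r x] r tau(1) by (simp add: has_vector_derivative_at_within)
    ultimately show "((\<lambda>r. y r - solution x r) has_vector_derivative 0) (at r within {0..t})"
      using has_vector_derivative_diff by fastforce
  qed (use False in simp)
  moreover have "y 0 = solution x 0"
    using dde_solution_initial_phase[OF sol, of 0] order_le_less_trans[of "ereal 0" "ereal t" c] t(2) False tau
    by (simp add: solution_before)
  ultimately show ?thesis by simp
qed

lemma cconst_W_in_Oy:
  assumes "x \<in> X"
  shows "cconst tau (W *v x) \<in> Oy"
proof -
  have "recover (cconst tau (W *v x)) = x"
    using tau(1) by (simp add: recover_def cconst_def recover_W)
  then show ?thesis
    using assms cconst_in_Cset by (simp add: Oy_def)
qed

lemma dde_solutions_agree:
  assumes "x \<in> X" "dde_solution tau F UNIV Oy 0 (cconst tau (W *v x)) y1 c1"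
    "dde_solution tau F UNIV Oy 0 (cconst tau (W *v x)) y2 c2" "-tau \<le> t" "ereal t < min c1 c2"
  shows "y1 t = y2 t"
  using dde_solution_unique[OF assms(1,2,4)] dde_solution_unique[OF assms(1,3,4)] assms(5) by simp

lemma dde_solution_output:
  assumes "x \<in> X" "dde_solution tau F UNIV Oy 0 (cconst tau (W *v x)) y c" "ereal T < c"
  shows "W' *v y T = Psi x"
  using dde_solution_unique[OF assms(1,2) _ assms(3)] tau
  by (simp add: solution_def Phi_T G_def W'_embed_mat)

lemma F_lipschitz_on_initial_data:
  assumes lip: "\<forall>x\<in>X. \<forall>x'\<in>X. infnorm (Psi x - Psi x') \<le> KP * infnorm (x - x')"
    and cond: "2 * (1 + KP / (w * w')) \<le> K * tau"
    and u: "u \<in> {cconst tau (W *v x) | x. x \<in> X}" and v: "v \<in> {cconst tau (W *v x) | x. x \<in> X}"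
  shows "infnorm (F t u - F t v) \<le> K * cnorm tau (Cdiff u v)"
proof -
  obtain x x' where xx': "x \<in> X" "x' \<in> X" "u = cconst tau (W *v x)" "v = cconst tau (W *v x')"
    using u v by blast
  define d where "d = infnorm (x - x')"
  have d: "0 \<le> d" by (simp add: d_def infnorm_pos_le)
  have cn: "cnorm tau (Cdiff u v) = w * d"
    using tau(1) infnorm_embed_mat[OF inj_iota, of w "x - x'"] w(1)
    by (simp add: xx' cnorm_Cdiff_cconst d_def matrix_vector_mult_diff_distrib)
  have "F t (cconst tau (W *v z)) = bump (T - tau) tau t *\<^sub>R G z" for z
    using tau(1) by (simp add: F_def recover_def cconst_def recover_W G_def)
  then have F_diff: "F t u - F t v = bump (T - tau) tau t *\<^sub>R (G x - G x')"
    by (simp add: xx' scaleR_diff_right)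
  have "G x - G x' = embed_mat kappa (1 / w') *v (Psi x - Psi x') - W *v (x - x')"
    by (simp add: G_def matrix_vector_mult_diff_distrib)
  then have "infnorm (G x - G x')
      \<le> infnorm (embed_mat kappa (1 / w') *v (Psi x - Psi x')) + infnorm (W *v (x - x'))"
    by (simp add: infnorm_diff_le)
  moreover have "infnorm (embed_mat kappa (1 / w') *v (Psi x - Psi x')) \<le> 1 / w' * (KP * d)"
    using infnorm_embed_mat[OF inj_kappa, of "1 / w'"] lip xx'(1,2) w(2) by (simp add: d_def divide_right_mono)
  moreover have "infnorm (W *v (x - x')) = w * d"
    using infnorm_embed_mat[OF inj_iota] w(1) by (simp add: d_def)
  ultimately have "infnorm (G x - G x') \<le> 1 / w' * (KP * d) + w * d"
    by linarith
  then have "infnorm (F t u - F t v) \<le> 2 / tau * (1 / w' * (KP * d) + w * d)"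
    unfolding F_diff infnorm_mul using abs_bump_le[OF tau(1)] tau(1)
    by (intro mult_mono) (auto simp: infnorm_pos_le)
  also have "\<dots> = 2 * (1 + KP / (w * w')) / tau * (w * d)"
    using w tau(1) by (simp add: field_simps)
  also have "\<dots> \<le> K * (w * d)"
    using cond tau(1) w(1) d by (intro mult_right_mono) (simp_all add: divide_le_eq mult.commute)
  finally show ?thesis
    using cn by simp
qed

end

theorem mainTheorem3:
  fixes k :: nat and T tau K K\<^sub>\<Psi> w w' :: real
    and X :: "(real^'n) set" and \<Psi> :: "real^'n \<Rightarrow> real^'q"
  assumes m_def: "CARD('m) = max CARD('n) CARD('q)"
    and T_pos: "T > 0"
    and X_open: "open X"
    and Psi_reg: "if k = 0 then continuous_on X \<Psi> else Ckb k X \<Psi>"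
    and KPsi_nonneg: "K\<^sub>\<Psi> \<ge> 0"
    and Psi_lip: "\<forall>x\<in>X. \<forall>x'\<in>X. infnorm (\<Psi> x - \<Psi> x') \<le> K\<^sub>\<Psi> * infnorm (x - x')"
    and K_nonneg: "K \<ge> 0"
    and tau: "0 < tau" "tau \<le> T"
    and w_pos: "w > 0" and w'_pos: "w' > 0"
    and cond: "K * tau \<ge> 2 * (1 + K\<^sub>\<Psi> / (w * w'))"
  shows "\<exists>(W :: real^'n^'m) (b :: real^'m) (W' :: real^'m^'q) (b' :: real^'q)
            (Oy :: (real \<Rightarrow> real^'m) set) (F :: real \<Rightarrow> (real \<Rightarrow> real^'m) \<Rightarrow> real^'m).
     let lam = (\<lambda>x. W *v x + b);
         O0 = {cconst tau (lam x) | x. x \<in> X}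
     in C_open tau Oy \<and> O0 \<subseteq> Oy \<and>
        (\<forall>x\<in>X. \<exists>y c. dde_solution tau F UNIV Oy 0 (cconst tau (lam x)) y c \<and> ereal T < c) \<and>
        C0kb Cadd Cscale (cnorm tau) infnorm (Cset tau) (UNIV \<times> Oy) k F \<and>
        (k = 0 \<longrightarrow>
           (\<forall>x\<in>X. \<forall>y1 c1 y2 c2.
              dde_solution tau F UNIV Oy 0 (cconst tau (lam x)) y1 c1 \<and>
              dde_solution tau F UNIV Oy 0 (cconst tau (lam x)) y2 c2 \<longrightarrow>
              (\<forall>t. - tau \<le> t \<and> ereal t < min c1 c2 \<longrightarrow> y1 t = y2 t))) \<and>
        (\<forall>x\<in>X. \<forall>y c. dde_solution tau F UNIV Oy 0 (cconst tau (lam x)) y c \<and> ereal T < c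
              \<longrightarrow> W' *v y T + b' = \<Psi> x) \<and>
        (\<forall>t u v. u \<in> O0 \<and> v \<in> O0 \<longrightarrow> infnorm (F t u - F t v) \<le> K * cnorm tau (Cdiff u v)) \<and>
        mat_infnorm W = w \<and> mat_infnorm W' = w'"
proof -
  have card: "CARD('n) \<le> CARD('m)" "CARD('q) \<le> CARD('m)"
    using m_def by auto
  obtain iota :: "'n \<Rightarrow> 'm" where inj_iota: "inj iota"
    using card_le_inj[of "UNIV :: 'n set" "UNIV :: 'm set"] card(1) by auto
  obtain kappa :: "'q \<Rightarrow> 'm" where inj_kappa: "inj kappa"
    using card_le_inj[of "UNIV :: 'q set" "UNIV :: 'm set"] card(2) by auto
  obtain DP where "deriv_family (+) (*\<^sub>R) infnorm infnorm UNIV (UNIV \<times> X) (\<lambda>_ x. \<Psi> x) k DP"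
    "\<forall>j\<in>{1..k}. bdd_above {ml_norm_inf j (DP j t x) | t x. (t, x) \<in> UNIV \<times> X}"
    by (rule regular_map_deriv_family[OF Psi_reg])
  then interpret C: ndde_construction tau T w w' X k \<Psi> DP iota kappa
    using tau w_pos w'_pos inj_iota inj_kappa X_open by unfold_locales auto
  show ?thesis
    unfolding Let_def
  proof (rule exI[of _ C.W], rule exI[of _ 0], rule exI[of _ C.W'], rule exI[of _ 0], rule exI[of _ C.Oy],
      rule exI[of _ C.F], unfold add_0_right, intro conjI)
    show "{cconst tau (C.W *v x) | x. x \<in> X} \<subseteq> C.Oy"
      using C.cconst_W_in_Oy by blast
    show "\<forall>x\<in>X. \<exists>y c. dde_solution tau C.F UNIV C.Oy 0 (cconst tau (C.W *v x)) y c \<and> ereal T < c"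
      using C.dde_solution_solution by blast
    show "k = 0 \<longrightarrow> (\<forall>x\<in>X. \<forall>y1 c1 y2 c2.
        dde_solution tau C.F UNIV C.Oy 0 (cconst tau (C.W *v x)) y1 c1 \<and>
        dde_solution tau C.F UNIV C.Oy 0 (cconst tau (C.W *v x)) y2 c2 \<longrightarrow>
        (\<forall>t. - tau \<le> t \<and> ereal t < min c1 c2 \<longrightarrow> y1 t = y2 t))"
      using C.dde_solutions_agree by blast
    show "\<forall>x\<in>X. \<forall>y c. dde_solution tau C.F UNIV C.Oy 0 (cconst tau (C.W *v x)) y c \<and> ereal T < c
        \<longrightarrow> C.W' *v y T = \<Psi> x"
      using C.dde_solution_output by blast
    show "\<forall>t u v. u \<in> {cconst tau (C.W *v x) | x. x \<in> X} \<and> v \<in> {cconst tau (C.W *v x) | x. x \<in> X}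
        \<longrightarrow> infnorm (C.F t u - C.F t v) \<le> K * cnorm tau (Cdiff u v)"
      using C.F_lipschitz_on_initial_data[OF Psi_lip cond] by blast
  qed (use C.open_Oy C.F_C0kb mat_infnorm_embed_mat[OF inj_iota]
      mat_infnorm_proj_mat[of w' kappa] w_pos w'_pos in simp_all)
qed

end
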